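(* Let $D\subset\mathbb R^n$ be bounded and open and $1<p<\infty$, $p'=p/(p-1)$. Suppose that $w_j\to u$ strongly in $W^{1,p}(D)$. Then $$A_p(\nabla w_j)\to A_p(\nabla u)\ \text{ in }L^{p'}(D,\mathbb R^n),\qquad V_p(\nabla w_j)\to V_p(\nabla u)\ \text{ in }L^2(D,\mathbb R^n).$$ More precisely, there is a constant $C_p$ such that for all $w,u\in W^{1,p}(D)$, with all norms taken on $D$, $$\|A_p(\nabla w)-A_p(\nabla u)\|_{p'}\le\begin{cases}C_p(\|\nabla w\|_p+\|\nabla u\|_p)^{p-2}\|\nabla w-\nabla u\|_p,&p\ge2,\\ C_p\|\nabla w-\nabla u\|_p^{p-1},&1<p<2.\end{cases}$$ In general, $$\|\Delta_pw_j-\Delta_pu\|_{W^{-1,p'}(D)}\le\|A_p(\nabla w_j)-A_p(\nabla u)\|_{p'}\to0.$$ If $u$ is $p$-harmonic in $D$, then $$\|\Delta_pw_j\|_{W^{-1,p'}(D)}\le\|A_p(\nabla w_j)-A_p(\nabla u)\|_{p'}\to0.$$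
   Context: $A_p(\xi)=|\xi|^{p-2}\xi$ and $V_p(\xi)=|\xi|^{(p-2)/2}\xi$ for $\xi\in\mathbb R^n$, both set equal to $0$ at $\xi=0$. $\Delta_pw=\operatorname{div}(A_p(\nabla w))$ in the distributional sense, i.e. $\langle\Delta_pw,\varphi\rangle=-\int_DA_p(\nabla w)\cdot\nabla\varphi\,dx$. $W^{1,p}_0(D)$ is the closure of $C_c^\infty(D)$ in $W^{1,p}(D)$; $W^{-1,p'}(D)$ is its dual with norm $\|T\|_{W^{-1,p'}(D)}=\sup\{|\langle T,\varphi\rangle|:\varphi\in W^{1,p}_0(D),\ \|\nabla\varphi\|_{L^p(D)}\le1\}$. A continuous $u\in W^{1,p}_{\mathrm{loc}}(D)$ is $p$-harmonic if $\Delta_pu=0$ in this weak sense. The constant $C_p$ depends only on $p$. *)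

theory Defs
  imports "HOL-Analysis.Analysis"
begin

text \<open>
  The constant of the theorem depends on \<open>p\<close> only and is therefore chosen before the dimension.
  A dimension encoded in a type cannot be quantified inside a formula, so \<open>n\<close> is a natural
  number here: a point of n-dimensional space is an extensional function on \<open>{..<n}\<close>, the topology
  is the product topology that the library puts on \<open>nat \<Rightarrow> real\<close>, and Lebesgue measure is the
  completed product of \<open>n\<close> copies of \<open>lborel\<close>.
\<close>

type_synonym vec = "nat \<Rightarrow> real"

definition Rn :: "nat \<Rightarrow> vec set" where
  "Rn n = ({..<n} \<rightarrow>\<^sub>E UNIV)"

definition vnorm :: "nat \<Rightarrow> vec \<Rightarrow> real" where
  "vnorm n \<xi> = L2_set \<xi> {..<n}"

definition bounded_Rn :: "nat \<Rightarrow> vec set \<Rightarrow> bool" where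
  "bounded_Rn n D \<longleftrightarrow> (\<exists>R. \<forall>x\<in>D. vnorm n x \<le> R)"

definition leb_on :: "nat \<Rightarrow> vec set \<Rightarrow> vec measure" where
  "leb_on n D = restrict_space (completion (Pi\<^sub>M {..<n} (\<lambda>_. lborel))) D"


subsection \<open>Lebesgue spaces\<close>

text \<open>
  \<open>Lnorm\<close> is the usual norm only for members of the space, because the Bochner integral of a
  non-integrable function is \<open>0\<close>; every use below is accompanied by a membership condition.
  Vector fields are measured with the Euclidean norm of their values, and only their components
  with index below \<open>n\<close> are relevant.
\<close>

definition Lp :: "vec measure \<Rightarrow> real \<Rightarrow> (vec \<Rightarrow> real) set" where
  "Lp M p = {f \<in> borel_measurable M. integrable M (\<lambda>x. \<bar>f x\<bar> powr p)}"

definition Lnorm :: "vec measure \<Rightarrow> real \<Rightarrow> (vec \<Rightarrow> real) \<Rightarrow> real" where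
  "Lnorm M p f = (\<integral>x. \<bar>f x\<bar> powr p \<partial>M) powr (1 / p)"

definition vLp :: "nat \<Rightarrow> vec measure \<Rightarrow> real \<Rightarrow> (vec \<Rightarrow> vec) set" where
  "vLp n M p = {F. (\<forall>i<n. (\<lambda>x. F x i) \<in> borel_measurable M) \<and>
                   integrable M (\<lambda>x. vnorm n (F x) powr p)}"

definition vLnorm :: "nat \<Rightarrow> vec measure \<Rightarrow> real \<Rightarrow> (vec \<Rightarrow> vec) \<Rightarrow> real" where
  "vLnorm n M p F = Lnorm M p (\<lambda>x. vnorm n (F x))"

definition vdiff :: "(vec \<Rightarrow> vec) \<Rightarrow> (vec \<Rightarrow> vec) \<Rightarrow> vec \<Rightarrow> vec" where
  "vdiff F G = (\<lambda>x i. F x i - G x i)"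

definition vLp_tendsto ::
    "nat \<Rightarrow> vec measure \<Rightarrow> real \<Rightarrow> (nat \<Rightarrow> vec \<Rightarrow> vec) \<Rightarrow> (vec \<Rightarrow> vec) \<Rightarrow> bool" where
  "vLp_tendsto n M p F G \<longleftrightarrow>
     (\<forall>j. F j \<in> vLp n M p) \<and> G \<in> vLp n M p \<and> (\<lambda>j. vLnorm n M p (vdiff (F j) G)) \<longlonglongrightarrow> 0"


subsection \<open>Test functions\<close>

definition partial :: "nat \<Rightarrow> (vec \<Rightarrow> real) \<Rightarrow> vec \<Rightarrow> real" where
  "partial i f x = deriv (\<lambda>t. f (x(i := t))) (x i)"

text \<open>All partial derivatives up to order \<open>k\<close> exist and are continuous.\<close>

primrec Ck :: "nat \<Rightarrow> nat \<Rightarrow> (vec \<Rightarrow> real) \<Rightarrow> bool" where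
  "Ck n 0 f \<longleftrightarrow> continuous_on (Rn n) f"
| "Ck n (Suc k) f \<longleftrightarrow> continuous_on (Rn n) f \<and>
     (\<forall>i<n. (\<forall>x\<in>Rn n. (\<lambda>t. f (x(i := t))) differentiable at (x i)) \<and> Ck n k (partial i f))"

text \<open>Smooth functions compactly supported in \<open>D\<close>, extended by zero to the whole space.\<close>

definition Cc_inf :: "nat \<Rightarrow> vec set \<Rightarrow> (vec \<Rightarrow> real) set" where
  "Cc_inf n D = {\<phi>. (\<forall>k. Ck n k \<phi>) \<and>
                    (\<exists>K. compact K \<and> K \<subseteq> D \<and> (\<forall>x\<in>Rn n - K. \<phi> x = 0))}"


subsection \<open>Weak gradients and Sobolev spaces\<close>

definition loc_integrable :: "nat \<Rightarrow> vec set \<Rightarrow> (vec \<Rightarrow> real) \<Rightarrow> bool" where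
  "loc_integrable n D f \<longleftrightarrow> (\<forall>K. compact K \<and> K \<subseteq> D \<longrightarrow> integrable (leb_on n K) f)"

definition is_weak_grad :: "nat \<Rightarrow> vec set \<Rightarrow> (vec \<Rightarrow> real) \<Rightarrow> (vec \<Rightarrow> vec) \<Rightarrow> bool" where
  "is_weak_grad n D w G \<longleftrightarrow> loc_integrable n D w \<and>
     (\<forall>i<n. loc_integrable n D (\<lambda>x. G x i) \<and>
        (\<forall>\<phi>\<in>Cc_inf n D.
           (\<integral>x. w x * partial i \<phi> x \<partial>leb_on n D) = - (\<integral>x. G x i * \<phi> x \<partial>leb_on n D)))"

text \<open>A representative; weak gradients on an open set are unique almost everywhere.\<close>

definition weak_grad :: "nat \<Rightarrow> vec set \<Rightarrow> (vec \<Rightarrow> real) \<Rightarrow> vec \<Rightarrow> vec" where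
  "weak_grad n D w = (SOME G. is_weak_grad n D w G)"

definition W1p :: "nat \<Rightarrow> real \<Rightarrow> vec set \<Rightarrow> (vec \<Rightarrow> real) set" where
  "W1p n p D = {w \<in> Lp (leb_on n D) p. \<exists>G \<in> vLp n (leb_on n D) p. is_weak_grad n D w G}"

definition W1p_loc :: "nat \<Rightarrow> real \<Rightarrow> vec set \<Rightarrow> (vec \<Rightarrow> real) set" where
  "W1p_loc n p D = {w. \<exists>G. is_weak_grad n D w G \<and>
     (\<forall>K. compact K \<and> K \<subseteq> D \<longrightarrow> w \<in> Lp (leb_on n K) p \<and> G \<in> vLp n (leb_on n K) p)}"

definition W1p_norm :: "nat \<Rightarrow> real \<Rightarrow> vec set \<Rightarrow> (vec \<Rightarrow> real) \<Rightarrow> real" where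
  "W1p_norm n p D w = Lnorm (leb_on n D) p w + vLnorm n (leb_on n D) p (weak_grad n D w)"

definition W1p_tendsto ::
    "nat \<Rightarrow> real \<Rightarrow> vec set \<Rightarrow> (nat \<Rightarrow> vec \<Rightarrow> real) \<Rightarrow> (vec \<Rightarrow> real) \<Rightarrow> bool" where
  "W1p_tendsto n p D w u \<longleftrightarrow>
     (\<forall>j. w j \<in> W1p n p D) \<and> u \<in> W1p n p D \<and> (\<lambda>j. W1p_norm n p D (\<lambda>x. w j x - u x)) \<longlonglongrightarrow> 0"

definition W1p_0 :: "nat \<Rightarrow> real \<Rightarrow> vec set \<Rightarrow> (vec \<Rightarrow> real) set" where
  "W1p_0 n p D = {\<phi>. \<exists>\<psi>. (\<forall>k. \<psi> k \<in> Cc_inf n D) \<and> W1p_tendsto n p D \<psi> \<phi>}"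

text \<open>The norm dual to \<open>W1p_0\<close>, with values in \<open>[0, \<infinity>]\<close> so that the supremum always exists.\<close>

definition dual_norm :: "nat \<Rightarrow> real \<Rightarrow> vec set \<Rightarrow> ((vec \<Rightarrow> real) \<Rightarrow> real) \<Rightarrow> ennreal" where
  "dual_norm n p D T =
     (SUP \<phi> \<in> {\<phi> \<in> W1p_0 n p D. vLnorm n (leb_on n D) p (weak_grad n D \<phi>) \<le> 1}. ennreal \<bar>T \<phi>\<bar>)"


subsection \<open>The p-Laplacian\<close>

text \<open>Both maps vanish at \<open>0\<close>: there the second factor is \<open>0\<close>, whatever the sign of the exponent.\<close>

definition A_map :: "nat \<Rightarrow> real \<Rightarrow> vec \<Rightarrow> vec" where
  "A_map n p \<xi> = (\<lambda>i. vnorm n \<xi> powr (p - 2) * \<xi> i)"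

definition V_map :: "nat \<Rightarrow> real \<Rightarrow> vec \<Rightarrow> vec" where
  "V_map n p \<xi> = (\<lambda>i. vnorm n \<xi> powr ((p - 2) / 2) * \<xi> i)"

definition A_grad :: "nat \<Rightarrow> real \<Rightarrow> vec set \<Rightarrow> (vec \<Rightarrow> real) \<Rightarrow> vec \<Rightarrow> vec" where
  "A_grad n p D w = (\<lambda>x. A_map n p (weak_grad n D w x))"

definition V_grad :: "nat \<Rightarrow> real \<Rightarrow> vec set \<Rightarrow> (vec \<Rightarrow> real) \<Rightarrow> vec \<Rightarrow> vec" where
  "V_grad n p D w = (\<lambda>x. V_map n p (weak_grad n D w x))"

text \<open>
  The functional is applied to test functions as well as to elements of \<open>W1p_0\<close>; for a test
  function the weak gradient agrees with the classical one almost everywhere.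
\<close>

definition plap :: "nat \<Rightarrow> real \<Rightarrow> vec set \<Rightarrow> (vec \<Rightarrow> real) \<Rightarrow> (vec \<Rightarrow> real) \<Rightarrow> real" where
  "plap n p D w \<phi> =
     - (\<integral>x. (\<Sum>i<n. A_grad n p D w x i * weak_grad n D \<phi> x i) \<partial>leb_on n D)"

definition p_harmonic :: "nat \<Rightarrow> real \<Rightarrow> vec set \<Rightarrow> (vec \<Rightarrow> real) \<Rightarrow> bool" where
  "p_harmonic n p D u \<longleftrightarrow>
     continuous_on D u \<and> u \<in> W1p_loc n p D \<and> (\<forall>\<phi>\<in>Cc_inf n D. plap n p D u \<phi> = 0)"

end

theory Submission
  imports Defs
begin

text \<open>
  Both maps have the form \<open>B\<^sub>s \<xi> = |\<xi>|\<^sup>s \<xi>\<close>, with \<open>s = p - 2\<close> and \<open>s = (p - 2) / 2\<close>. Pointwise,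
  \<open>|B\<^sub>s \<xi> - B\<^sub>s \<eta>|\<close> is at most a constant times \<open>(|\<xi>| + |\<eta>|)\<^sup>s |\<xi> - \<eta>|\<close> if \<open>s \<ge> 0\<close> and at most
  \<open>2 |\<xi> - \<eta>|\<^sup>s\<^sup>+\<^sup>1\<close> if \<open>-1 < s < 0\<close>. Hoelder's inequality turns this into continuity of
  \<open>B\<^sub>s\<close> from \<open>L\<^sup>p\<close> to the Lebesgue space with exponent \<open>p / (s + 1)\<close>, which is \<open>p'\<close> and \<open>2\<close>
  in the two cases. The weak gradient is an arbitrary choice, so its integrability and its linearity need
  uniqueness almost everywhere: a locally integrable function that annihilates the test functions
  \<open>\<Prod>\<^sub>i f(k (x\<^sub>i - c\<^sub>i)) f(k (d\<^sub>i - x\<^sub>i))\<close>, where \<open>f(t) = exp(- 1 / t)\<close> for \<open>t > 0\<close> and \<open>f(t) = 0\<close>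
  otherwise, has integral zero over every cell. The dual estimates are Hoelder's inequality, and
  a p-harmonic \<open>u\<close> has \<open>\<Delta>\<^sub>p u = 0\<close> on \<open>W\<^sub>0\<^sup>1\<^sup>,\<^sup>p\<close> by density of the test functions.
\<close>


subsection \<open>Power maps of vectors\<close>

definition pow_map :: "nat \<Rightarrow> real \<Rightarrow> vec \<Rightarrow> vec" where
  "pow_map n s \<xi> = (\<lambda>i. vnorm n \<xi> powr s * \<xi> i)"

lemma vnorm_nonneg [simp]: "0 \<le> vnorm n \<xi>"
  by (simp add: vnorm_def)

lemma vnorm_cong: "(\<And>i. i < n \<Longrightarrow> \<xi> i = \<eta> i) \<Longrightarrow> vnorm n \<xi> = vnorm n \<eta>"
  unfolding vnorm_def by (rule L2_set_cong) auto

lemma vnorm_add_le: "vnorm n (\<lambda>i. \<xi> i + \<eta> i) \<le> vnorm n \<xi> + vnorm n \<eta>"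
  unfolding vnorm_def by (rule L2_set_triangle_ineq)

lemma vnorm_scale: "vnorm n (\<lambda>i. c * \<xi> i) = \<bar>c\<bar> * vnorm n \<xi>"
proof -
  have "vnorm n (\<lambda>i. c * \<xi> i) = vnorm n (\<lambda>i. \<bar>c\<bar> * \<xi> i)"
    by (simp add: vnorm_def L2_set_def power_mult_distrib)
  also have "\<dots> = \<bar>c\<bar> * vnorm n \<xi>"
    by (simp add: vnorm_def L2_set_right_distrib)
  finally show ?thesis .
qed

lemma vnorm_diff_commute: "vnorm n (\<lambda>i. \<xi> i - \<eta> i) = vnorm n (\<lambda>i. \<eta> i - \<xi> i)"
  by (simp add: vnorm_def L2_set_def power2_commute)

lemma vnorm_diff_le: "vnorm n (\<lambda>i. \<xi> i - \<eta> i) \<le> vnorm n \<xi> + vnorm n \<eta>"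
  using vnorm_add_le[of n \<xi> "\<lambda>i. (-1) * \<eta> i"] vnorm_scale[of n "-1" \<eta>] by simp

lemma vnorm_diff_ge: "vnorm n \<xi> - vnorm n \<eta> \<le> vnorm n (\<lambda>i. \<xi> i - \<eta> i)"
  using vnorm_add_le[of n "\<lambda>i. \<xi> i - \<eta> i" \<eta>] by simp

lemma vnorm_pow_map: "vnorm n (pow_map n s \<xi>) = vnorm n \<xi> powr (s + 1)"
  by (simp only: pow_map_def vnorm_scale) (simp add: powr_add)

text \<open>Adding and subtracting \<open>vnorm n \<xi> powr s * \<eta> i\<close> separates the
  displacement from the change of the radial factor. The asymmetry is deliberate: both estimates
  below apply the bound with \<xi> as the longer vector.\<close>

lemma pow_map_diff_le:
  "vnorm n (\<lambda>i. pow_map n s \<xi> i - pow_map n s \<eta> i)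
     \<le> vnorm n \<xi> powr s * vnorm n (\<lambda>i. \<xi> i - \<eta> i)
        + \<bar>vnorm n \<xi> powr s - vnorm n \<eta> powr s\<bar> * vnorm n \<eta>"
proof -
  let ?a = "vnorm n \<xi> powr s" and ?b = "vnorm n \<eta> powr s"
  have "(\<lambda>i. pow_map n s \<xi> i - pow_map n s \<eta> i)
      = (\<lambda>i. ?a * (\<xi> i - \<eta> i) + (?a - ?b) * \<eta> i)"
    by (simp add: pow_map_def fun_eq_iff algebra_simps)
  then show ?thesis
    using vnorm_add_le[of n "\<lambda>i. ?a * (\<xi> i - \<eta> i)" "\<lambda>i. (?a - ?b) * \<eta> i"]
    by (simp only: vnorm_scale) simp
qed

text \<open>By homogeneity everything reduces to the ratio \<open>t = b / a\<close>, for which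
  \<open>1 + x \<le> exp x\<close> and \<open>ln (1 / t) \<le> 1 / t - 1\<close> are enough. Going
  through the logarithm treats exponents below and above 1 together.\<close>

lemma powr_diff_mult_le:
  fixes a b s :: real
  assumes "0 \<le> b" "b \<le> a" "0 \<le> s"
  shows "(a powr s - b powr s) * b \<le> s * a powr s * (a - b)"
proof (cases "b = 0")
  case True
  then show ?thesis using assms by simp
next
  case False
  define t where "t = b / a"
  have t: "0 < t" "b = t * a" "0 < a" using assms False by (auto simp: t_def)
  have "1 - t powr s \<le> - (s * ln t)"
    using exp_ge_add_one_self[of "s * ln t"] t by (simp add: powr_def del: exp_ge_add_one_self)
  then have "(1 - t powr s) * t \<le> - (s * ln t) * t"
    using t by (intro mult_right_mono) auto
  also have "- (s * ln t) * t = s * (ln (1 / t) * t)"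
    using t by (simp add: ln_div)
  also have "\<dots> \<le> s * ((1 / t - 1) * t)"
    using t assms ln_le_minus_one[of "1 / t"] by (intro mult_left_mono mult_right_mono) auto
  also have "\<dots> = s * (1 - t)"
    using t by (simp add: field_simps)
  finally have "(a powr s * a) * ((1 - t powr s) * t) \<le> (a powr s * a) * (s * (1 - t))"
    using t by (intro mult_left_mono) auto
  then show ?thesis
    using t by (simp add: powr_mult algebra_simps)
qed

text \<open>By symmetry \<xi> may be taken as the longer vector. In \<open>1 + s\<close>, the 1
  comes from the displacement and the s from the radial factor, whose change is controlled by
  \<open>powr_diff_mult_le\<close> and the reverse triangle inequality.\<close>

lemma pow_map_diff_nonneg_exponent:
  assumes "0 \<le> s"
  shows "vnorm n (\<lambda>i. pow_map n s \<xi> i - pow_map n s \<eta> i)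
    \<le> (1 + s) * (vnorm n \<xi> + vnorm n \<eta>) powr s * vnorm n (\<lambda>i. \<xi> i - \<eta> i)"
proof -
  have *: "vnorm n (\<lambda>i. pow_map n s \<xi> i - pow_map n s \<eta> i)
    \<le> (1 + s) * (vnorm n \<xi> + vnorm n \<eta>) powr s * vnorm n (\<lambda>i. \<xi> i - \<eta> i)"
    if le: "vnorm n \<eta> \<le> vnorm n \<xi>" for \<xi> \<eta>
  proof -
    let ?a = "vnorm n \<xi>" and ?b = "vnorm n \<eta>" and ?d = "vnorm n (\<lambda>i. \<xi> i - \<eta> i)"
    have "?b powr s \<le> ?a powr s"
      using le assms by (intro powr_mono2) auto
    then have "\<bar>?a powr s - ?b powr s\<bar> * ?b \<le> s * ?a powr s * (?a - ?b)"
      using powr_diff_mult_le[of ?b ?a s] le assms by simp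
    also have "\<dots> \<le> s * ?a powr s * ?d"
      using assms vnorm_diff_ge[of n \<xi> \<eta>] by (intro mult_left_mono) auto
    finally have "vnorm n (\<lambda>i. pow_map n s \<xi> i - pow_map n s \<eta> i) \<le> (1 + s) * ?a powr s * ?d"
      using pow_map_diff_le[of n s \<xi> \<eta>] by (simp add: algebra_simps)
    also have "\<dots> \<le> (1 + s) * (?a + ?b) powr s * ?d"
      using assms by (intro mult_right_mono mult_left_mono powr_mono2) auto
    finally show ?thesis .
  qed
  show ?thesis
  proof (cases "vnorm n \<eta> \<le> vnorm n \<xi>")
    case False
    then show ?thesis
      using *[of \<xi> \<eta>]
      by (simp add: vnorm_diff_commute[of n "pow_map n s \<xi>"] vnorm_diff_commute[of n \<xi>] add.commute)
  qed (rule *)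
qed

text \<open>Let \<xi> be the longer vector and d the distance. If \<xi> is no longer than d, both
  images have length at most \<open>d powr (s + 1)\<close>. Otherwise the negative power gives
  \<open>vnorm n \<xi> powr s \<le> d powr s\<close>, and each of the two terms of
  \<open>pow_map_diff_le\<close> is at most \<open>d powr (s + 1)\<close>. Either way the constant
  is 2.\<close>

lemma pow_map_diff_neg_exponent:
  assumes "-1 < s" "s < 0"
  shows "vnorm n (\<lambda>i. pow_map n s \<xi> i - pow_map n s \<eta> i)
    \<le> 2 * vnorm n (\<lambda>i. \<xi> i - \<eta> i) powr (s + 1)"
proof -
  have *: "vnorm n (\<lambda>i. pow_map n s \<xi> i - pow_map n s \<eta> i)
    \<le> 2 * vnorm n (\<lambda>i. \<xi> i - \<eta> i) powr (s + 1)"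
    if le: "vnorm n \<eta> \<le> vnorm n \<xi>" for \<xi> \<eta>
  proof -
    let ?a = "vnorm n \<xi>" and ?b = "vnorm n \<eta>" and ?d = "vnorm n (\<lambda>i. \<xi> i - \<eta> i)"
    show ?thesis
    proof (cases "?a \<le> ?d")
      case True
      have "vnorm n (\<lambda>i. pow_map n s \<xi> i - pow_map n s \<eta> i) \<le> ?a powr (s + 1) + ?b powr (s + 1)"
        using vnorm_diff_le[of n "pow_map n s \<xi>" "pow_map n s \<eta>"] by (simp add: vnorm_pow_map)
      also have "\<dots> \<le> ?d powr (s + 1) + ?d powr (s + 1)"
        using True le assms by (intro add_mono powr_mono2) auto
      finally show ?thesis by simp
    next
      case False
      then have pos: "0 < ?a" using vnorm_nonneg[of n "\<lambda>i. \<xi> i - \<eta> i"] by linarith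
      have ad: "?a powr s * ?d \<le> ?d powr (s + 1)"
      \<comment> \<open>Here \<open>0 powr s\<close> is 0 even for negative s, so a negative power
        decreases only on positive arguments and zero has to be split off.\<close>
      proof (cases "?d = 0")
        case d: False
        then have "0 < ?d" by (simp add: less_le)
        then have "?a powr s \<le> ?d powr s"
          using False assms by (intro powr_mono2') auto
        then show ?thesis
          by (simp add: powr_add mult_right_mono)
      qed auto
      \<comment> \<open>The negative exponent reverses the order of the radial factors, but the
        exponent \<open>s + 1\<close> is still positive and preserves it.\<close>
      have "\<bar>?a powr s - ?b powr s\<bar> * ?b \<le> ?a powr s * (?a - ?b)"
      proof (cases "?b = 0")
        case b: False
        then have b: "0 < ?b" by (simp add: less_le)
        have "?a powr s \<le> ?b powr s"
          using b le assms by (intro powr_mono2') auto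
        then have "\<bar>?a powr s - ?b powr s\<bar> * ?b = ?b powr (s + 1) - ?a powr s * ?b"
          using b by (simp add: powr_add algebra_simps)
        also have "\<dots> \<le> ?a powr (s + 1) - ?a powr s * ?b"
          using le assms by (intro diff_right_mono powr_mono2) auto
        finally show ?thesis
          using pos by (simp add: powr_add algebra_simps)
      qed auto
      also have "\<dots> \<le> ?a powr s * ?d"
        using vnorm_diff_ge[of n \<xi> \<eta>] by (intro mult_left_mono) auto
      finally show ?thesis
        using pow_map_diff_le[of n s \<xi> \<eta>] ad by linarith
    qed
  qed
  show ?thesis
  proof (cases "vnorm n \<eta> \<le> vnorm n \<xi>")
    case False
    then show ?thesis
      using *[of \<xi> \<eta>]
      by (simp add: vnorm_diff_commute[of n "pow_map n s \<xi>"] vnorm_diff_commute[of n \<xi>])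
  qed (rule *)
qed


subsection \<open>Power maps on Lebesgue spaces\<close>

text \<open>Comparison with twice the larger term avoids convexity, so exponents below 1 are covered
  as well.\<close>

lemma powr_add_le:
  fixes x y p :: real
  assumes "0 \<le> x" "0 \<le> y" "0 < p"
  shows "(x + y) powr p \<le> 2 powr p * (x powr p + y powr p)"
proof -
  have "(x + y) powr p \<le> (2 * max x y) powr p"
    using assms by (intro powr_mono2) auto
  also have "\<dots> = 2 powr p * max x y powr p"
    using assms by (simp add: powr_mult)
  also have "\<dots> \<le> 2 powr p * (x powr p + y powr p)"
    by (intro mult_left_mono) (auto simp: max_def)
  finally show ?thesis .
qed

text \<open>Young's inequality itself gives integrability of the product. Applied to the factors
  divided by their norms, it integrates to \<open>1 / p + 1 / q\<close>. If one norm is zero, the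
  product vanishes almost everywhere.\<close>

lemma Hoelder_inequality:
  fixes f g :: "'a \<Rightarrow> real"
  assumes pq: "1 < p" "1 < q" "1 / p + 1 / q = 1"
    and [measurable]: "f \<in> borel_measurable M" "g \<in> borel_measurable M"
    and nonneg: "\<And>x. 0 \<le> f x" "\<And>x. 0 \<le> g x"
    and int: "integrable M (\<lambda>x. f x powr p)" "integrable M (\<lambda>x. g x powr q)"
  shows "integrable M (\<lambda>x. f x * g x)"
    and "(\<integral>x. f x * g x \<partial>M) \<le> (\<integral>x. f x powr p \<partial>M) powr (1 / p) * (\<integral>x. g x powr q \<partial>M) powr (1 / q)"
proof -
  let ?A = "\<integral>x. f x powr p \<partial>M" and ?B = "\<integral>x. g x powr q \<partial>M"
  show i: "integrable M (\<lambda>x. f x * g x)"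
  proof (rule Bochner_Integration.integrable_bound)
    show "integrable M (\<lambda>x. f x powr p / p + g x powr q / q)"
      using int by auto
    show "AE x in M. norm (f x * g x) \<le> norm (f x powr p / p + g x powr q / q)"
      using Youngs_inequality[OF pq] nonneg pq by (auto simp: abs_of_nonneg)
  qed simp
  have A0: "0 \<le> ?A" and B0: "0 \<le> ?B" by auto
  show "(\<integral>x. f x * g x \<partial>M) \<le> ?A powr (1 / p) * ?B powr (1 / q)"
  proof (cases "?A = 0 \<or> ?B = 0")
    case True
    then have "AE x in M. f x * g x = 0"
    proof
      assume "?A = 0"
      then have "AE x in M. f x powr p = 0"
        using integral_nonneg_eq_0_iff_AE[OF int(1)] by simp
      then show ?thesis by eventually_elim simp
    next
      assume "?B = 0"
      then have "AE x in M. g x powr q = 0"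
        using integral_nonneg_eq_0_iff_AE[OF int(2)] by simp
      then show ?thesis by eventually_elim simp
    qed
    then have "(\<integral>x. f x * g x \<partial>M) = 0"
      by (subst integral_cong_AE[of _ _ "\<lambda>_. 0"]) auto
    then show ?thesis by simp
  next
    case False
    define a where "a = ?A powr (1 / p)"
    define b where "b = ?B powr (1 / q)"
    have ab: "0 < a" "0 < b" "a powr p = ?A" "b powr q = ?B"
      using False A0 B0 pq by (auto simp: a_def b_def powr_powr)
    have "(\<integral>x. f x * g x / (a * b) \<partial>M) \<le> (\<integral>x. f x powr p / ?A / p + g x powr q / ?B / q \<partial>M)"
    proof (rule integral_mono)
      fix x
      have "f x / a * (g x / b) \<le> (f x / a) powr p / p + (g x / b) powr q / q"
        using nonneg ab by (intro Youngs_inequality[OF pq]) (auto simp: less_imp_le)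
      then show "f x * g x / (a * b) \<le> f x powr p / ?A / p + g x powr q / ?B / q"
        using nonneg ab by (simp add: powr_divide)
    qed (use int i in auto)
    also have "\<dots> = 1 / p + 1 / q"
      using int False by (simp add: Bochner_Integration.integral_add)
    finally have "(\<integral>x. f x * g x \<partial>M) / (a * b) \<le> 1"
      using pq by simp
    then show ?thesis
      using ab unfolding a_def[symmetric] b_def[symmetric] by (simp add: divide_le_eq)
  qed
qed

section \<open>Lebesgue spaces of vector fields\<close>

lemma vnorm_measurable:
  assumes "\<And>i. i < n \<Longrightarrow> (\<lambda>x. F x i) \<in> borel_measurable M"
  shows "(\<lambda>x. vnorm n (F x)) \<in> borel_measurable M"
  unfolding vnorm_def L2_set_def using assms by measurable

lemma vLp_vnorm_measurable:
  "F \<in> vLp n M p \<Longrightarrow> (\<lambda>x. vnorm n (F x)) \<in> borel_measurable M"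
  by (rule vnorm_measurable) (simp add: vLp_def)

lemma vLp_integrable: "F \<in> vLp n M p \<Longrightarrow> integrable M (\<lambda>x. vnorm n (F x) powr p)"
  by (simp add: vLp_def)

lemma vLnorm_eq: "vLnorm n M p F = (\<integral>x. vnorm n (F x) powr p \<partial>M) powr (1 / p)"
  by (simp add: vLnorm_def Lnorm_def)

lemma vLnorm_nonneg [simp]: "0 \<le> vLnorm n M p F"
  by (simp add: vLnorm_eq)

lemma vLnorm_powr: "0 < p \<Longrightarrow> vLnorm n M p F powr p = (\<integral>x. vnorm n (F x) powr p \<partial>M)"
  by (simp add: vLnorm_eq powr_powr)

lemma integrable_vnorm_add_powr:
  assumes F: "F \<in> vLp n M p" and G: "G \<in> vLp n M p" and p: "0 < p"
  shows "integrable M (\<lambda>x. (vnorm n (F x) + vnorm n (G x)) powr p)"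
proof (rule Bochner_Integration.integrable_bound)
  show "integrable M (\<lambda>x. 2 powr p * (vnorm n (F x) powr p + vnorm n (G x) powr p))"
    using F G by (auto simp: vLp_def)
  show "(\<lambda>x. (vnorm n (F x) + vnorm n (G x)) powr p) \<in> borel_measurable M"
    using vLp_vnorm_measurable[OF F] vLp_vnorm_measurable[OF G] by measurable
  show "AE x in M. norm ((vnorm n (F x) + vnorm n (G x)) powr p)
      \<le> norm (2 powr p * (vnorm n (F x) powr p + vnorm n (G x) powr p))"
    using powr_add_le p by (auto simp: abs_of_nonneg)
qed

lemma vnorm_vdiff_le: "vnorm n (vdiff F G x) \<le> vnorm n (F x) + vnorm n (G x)"
  unfolding vdiff_def by (rule vnorm_diff_le)

lemma vdiff_measurable:
  assumes "F \<in> vLp n M p" "G \<in> vLp n M p" "i < n"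
  shows "(\<lambda>x. vdiff F G x i) \<in> borel_measurable M"
  using assms unfolding vdiff_def vLp_def by (intro borel_measurable_diff) auto

lemma vLp_vdiff:
  assumes F: "F \<in> vLp n M p" and G: "G \<in> vLp n M p" and p: "0 < p"
  shows "vdiff F G \<in> vLp n M p"
proof -
  have m: "(\<lambda>x. vnorm n (vdiff F G x)) \<in> borel_measurable M"
    using vdiff_measurable[OF F G] by (intro vnorm_measurable)
  have "integrable M (\<lambda>x. vnorm n (vdiff F G x) powr p)"
  proof (rule Bochner_Integration.integrable_bound)
    show "integrable M (\<lambda>x. (vnorm n (F x) + vnorm n (G x)) powr p)"
      by (rule integrable_vnorm_add_powr[OF F G p])
    show "AE x in M. norm (vnorm n (vdiff F G x) powr p)
        \<le> norm ((vnorm n (F x) + vnorm n (G x)) powr p)"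
      using vnorm_vdiff_le p by (auto intro!: powr_mono2)
  qed (use m in measurable)
  then show ?thesis
    using vdiff_measurable[OF F G] by (simp add: vLp_def)
qed

text \<open>The constant 4 replaces Minkowski's constant 1, which is not needed.\<close>

lemma integral_vnorm_add_powr_le:
  assumes F: "F \<in> vLp n M p" and G: "G \<in> vLp n M p" and p: "1 \<le> p"
  shows "(\<integral>x. (vnorm n (F x) + vnorm n (G x)) powr p \<partial>M) powr (1 / p)
    \<le> 4 * (vLnorm n M p F + vLnorm n M p G)"
proof -
  let ?N = "vLnorm n M p F + vLnorm n M p G"
  have "(\<integral>x. (vnorm n (F x) + vnorm n (G x)) powr p \<partial>M)
      \<le> (\<integral>x. 2 powr p * (vnorm n (F x) powr p + vnorm n (G x) powr p) \<partial>M)"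
    using F G p integrable_vnorm_add_powr[OF F G]
    by (intro integral_mono powr_add_le) (auto simp: vLp_def)
  also have "\<dots> = 2 powr p * (vLnorm n M p F powr p + vLnorm n M p G powr p)"
    using F G p by (simp add: vLnorm_powr vLp_def)
  also have "\<dots> \<le> 2 powr p * (?N powr p + ?N powr p)"
    using p by (intro mult_left_mono add_mono powr_mono2) auto
  \<comment> \<open>The sum of two equal terms costs \<open>2 powr 1\<close>, hence at most
    \<open>2 powr p\<close> as p is at least 1. The two factors \<open>2 powr p\<close> turn into 4
    under the p-th root.\<close>
  also have "\<dots> = 2 powr p * (2 powr 1 * ?N powr p)"
    by simp
  also have "\<dots> \<le> 2 powr p * (2 powr p * ?N powr p)"
    using p by (intro mult_left_mono mult_right_mono powr_mono) auto
  also have "\<dots> = (4 * ?N) powr p"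
    by (simp add: powr_mult flip: powr_mult)
  finally have "(\<integral>x. (vnorm n (F x) + vnorm n (G x)) powr p \<partial>M) powr (1 / p)
      \<le> ((4 * ?N) powr p) powr (1 / p)"
    using p by (intro powr_mono2) auto
  then show ?thesis
    using p by (simp add: powr_powr)
qed

text \<open>The comparison survives a non-integrable left side, whose integral is 0 by default,
  because the majorant is nonnegative.\<close>

lemma vLnorm_mono:
  assumes "integrable M g" "\<And>x. vnorm n (F x) powr p \<le> g x" "0 < p"
  shows "vLnorm n M p F \<le> (\<integral>x. g x \<partial>M) powr (1 / p)"
proof -
  have "(\<integral>x. vnorm n (F x) powr p \<partial>M) \<le> (\<integral>x. g x \<partial>M)"
    using assms by (intro integral_mono') (auto intro: order_trans[OF _ assms(2)])
  then show ?thesis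
    unfolding vLnorm_eq using assms by (intro powr_mono2) auto
qed

lemma vLnorm_vdiff_le:
  assumes F: "F \<in> vLp n M p" and G: "G \<in> vLp n M p" and p: "1 \<le> p"
  shows "vLnorm n M p (vdiff F G) \<le> 4 * (vLnorm n M p F + vLnorm n M p G)"
proof -
  have "vLnorm n M p (vdiff F G)
      \<le> (\<integral>x. (vnorm n (F x) + vnorm n (G x)) powr p \<partial>M) powr (1 / p)"
    using p integrable_vnorm_add_powr[OF F G] vnorm_vdiff_le
    by (intro vLnorm_mono powr_mono2) auto
  then show ?thesis
    using integral_vnorm_add_powr_le[OF F G p] by simp
qed

section \<open>Continuity of the power maps between Lebesgue spaces\<close>

text \<open>The target exponent is the one for which, by \<open>vnorm_pow_map\<close>, the power of
  the new length is exactly the p-th power of the old length.\<close>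

lemma vLp_pow_map:
  assumes F: "F \<in> vLp n M p" and s: "-1 < s"
  shows "(\<lambda>x. pow_map n s (F x)) \<in> vLp n M (p / (s + 1))"
proof -
  have "(\<lambda>x. pow_map n s (F x) i) \<in> borel_measurable M" if "i < n" for i
  proof -
    have [measurable]: "(\<lambda>x. F x i) \<in> borel_measurable M" "(\<lambda>x. vnorm n (F x)) \<in> borel_measurable M"
      using F that vLp_vnorm_measurable[OF F] by (auto simp: vLp_def)
    show ?thesis
      unfolding pow_map_def by measurable
  qed
  moreover have "vnorm n (pow_map n s (F x)) powr (p / (s + 1)) = vnorm n (F x) powr p" for x
    using s by (simp add: vnorm_pow_map powr_powr)
  ultimately show ?thesis
    using F by (simp add: vLp_def)
qed

text \<open>With \<open>r = p / (s + 1)\<close>, the r-th power of the pointwise bound contains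
  \<open>h powr (s * r)\<close> and \<open>d powr r\<close>, where h is the sum of the two lengths
  and d the distance. Hoelder's inequality with exponents \<open>(s + 1) / s\<close> and
  \<open>s + 1\<close> turns both into p-th powers. The factor \<open>4 powr s\<close> comes from
  the constant 4 in the bound for the norm of h.\<close>

lemma vLnorm_pow_map_diff_nonneg_exponent:
  assumes F: "F \<in> vLp n M p" and G: "G \<in> vLp n M p" and p: "1 \<le> p" and s: "0 \<le> s"
  shows "vLnorm n M (p / (s + 1)) (vdiff (\<lambda>x. pow_map n s (F x)) (\<lambda>x. pow_map n s (G x)))
    \<le> (1 + s) * 4 powr s * (vLnorm n M p F + vLnorm n M p G) powr s * vLnorm n M p (vdiff F G)"
proof -
  define r where "r = p / (s + 1)"
  have r: "0 < r" "p = r * (s + 1)" using p s by (auto simp: r_def)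
  let ?H = "vdiff (\<lambda>x. pow_map n s (F x)) (\<lambda>x. pow_map n s (G x))"
  let ?h = "\<lambda>x. vnorm n (F x) + vnorm n (G x)" and ?d = "\<lambda>x. vnorm n (vdiff F G x)"
  let ?N = "vLnorm n M p F + vLnorm n M p G"
  have D: "vdiff F G \<in> vLp n M p"
    using vLp_vdiff[OF F G] p by simp
  have m [measurable]: "(\<lambda>x. vnorm n (F x)) \<in> borel_measurable M"
     "(\<lambda>x. vnorm n (G x)) \<in> borel_measurable M" "?d \<in> borel_measurable M"
    using F G D vLp_vnorm_measurable by blast+
  have pw: "vnorm n (?H x) powr r \<le> (1 + s) powr r * (?h x powr (s * r) * ?d x powr r)" for x
  proof -
    have "vnorm n (?H x) powr r \<le> ((1 + s) * ?h x powr s * ?d x) powr r"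
      using pow_map_diff_nonneg_exponent[OF s, of n "F x" "G x"] r
      by (intro powr_mono2) (auto simp: vdiff_def)
    then show ?thesis
      using s by (simp add: powr_mult powr_powr mult.assoc)
  qed
  show ?thesis
  \<comment> \<open>For s = 0 the exponent \<open>(s + 1) / s\<close> is meaningless, and the
    pointwise bound suffices.\<close>
  proof (cases "s = 0")
    case True
    have "vLnorm n M r ?H \<le> (\<integral>x. ?d x powr p \<partial>M) powr (1 / r)"
    proof (rule vLnorm_mono)
      show "vnorm n (?H x) powr r \<le> ?d x powr p" for x
        using pw[of x] True r by (cases "?h x = 0") (auto split: if_splits)
    qed (use r D in \<open>auto simp: vLp_def\<close>)
    then have "vLnorm n M r ?H \<le> vLnorm n M p (vdiff F G)"
      using r True by (simp add: vLnorm_eq)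
    \<comment> \<open>Since \<open>0 powr 0\<close> is 0, the right side of the claim vanishes when
      both norms do; the left side must then be shown to vanish too.\<close>
    moreover have "vLnorm n M p (vdiff F G) = 0" if "?N = 0"
      using vLnorm_vdiff_le[OF F G p] vLnorm_nonneg[of n M p "vdiff F G"] unfolding that by linarith
    ultimately show ?thesis
      using True unfolding r_def[symmetric] by (cases "?N = 0") auto
  next
    case False
    then have s: "0 < s" using s by simp
    let ?P = "(s + 1) / s" and ?Q = "s + 1"
    have e: "(?h x powr (s * r)) powr ?P = ?h x powr p" "(?d x powr r) powr ?Q = ?d x powr p" for x
    proof -
      have "s * r * ?P = p" "r * ?Q = p"
        using s r by (auto simp: field_simps)
      then show "(?h x powr (s * r)) powr ?P = ?h x powr p" "(?d x powr r) powr ?Q = ?d x powr p"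
        by (simp_all only: powr_powr)
    qed
    have pq: "1 < ?P" "1 < ?Q" "1 / ?P + 1 / ?Q = 1"
      using s by (auto simp: field_simps)
    note H = Hoelder_inequality[OF pq, of "\<lambda>x. ?h x powr (s * r)" M "\<lambda>x. ?d x powr r", unfolded e]
    have i: "integrable M (\<lambda>x. ?h x powr p)" "integrable M (\<lambda>x. ?d x powr p)"
      using integrable_vnorm_add_powr[OF F G] p D by (auto simp: vLp_def)
    have ihd: "integrable M (\<lambda>x. ?h x powr (s * r) * ?d x powr r)"
      by (rule H(1)) (use i in auto)
    have "vLnorm n M r ?H \<le> (\<integral>x. (1 + s) powr r * (?h x powr (s * r) * ?d x powr r) \<partial>M) powr (1 / r)"
      using pw r ihd by (intro vLnorm_mono) auto
    also have "\<dots> = (1 + s) * (\<integral>x. ?h x powr (s * r) * ?d x powr r \<partial>M) powr (1 / r)"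
      using s r by (simp add: powr_mult powr_powr integral_nonneg_AE)
    also have "\<dots> \<le> (1 + s) * ((\<integral>x. ?h x powr p \<partial>M) powr (1 / ?P) * (\<integral>x. ?d x powr p \<partial>M) powr (1 / ?Q)) powr (1 / r)"
      using s r by (intro mult_left_mono powr_mono2 H(2) i) (auto intro: integral_nonneg_AE)
    also have "\<dots> = (1 + s) * (((\<integral>x. ?h x powr p \<partial>M) powr (1 / p)) powr s * vLnorm n M p (vdiff F G))"
      using s r by (simp add: powr_mult powr_powr vLnorm_eq field_simps)
    also have "\<dots> \<le> (1 + s) * ((4 * ?N) powr s * vLnorm n M p (vdiff F G))"
      using s integral_vnorm_add_powr_le[OF F G p]
      by (intro mult_left_mono mult_right_mono powr_mono2) auto
    finally show ?thesis
      unfolding r_def by (simp only: powr_mult mult.assoc)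
  qed
qed

text \<open>The power \<open>p / (s + 1)\<close> of the pointwise bound is already a multiple of the
  p-th power of the distance, so integrating it is enough.\<close>

lemma vLnorm_pow_map_diff_neg_exponent:
  assumes F: "F \<in> vLp n M p" and G: "G \<in> vLp n M p" and p: "0 < p" and s: "-1 < s" "s < 0"
  shows "vLnorm n M (p / (s + 1)) (vdiff (\<lambda>x. pow_map n s (F x)) (\<lambda>x. pow_map n s (G x)))
    \<le> 2 * vLnorm n M p (vdiff F G) powr (s + 1)"
proof -
  define r where "r = p / (s + 1)"
  have r: "0 < r" "p = r * (s + 1)" using p s by (auto simp: r_def)
  let ?H = "vdiff (\<lambda>x. pow_map n s (F x)) (\<lambda>x. pow_map n s (G x))"
  let ?d = "\<lambda>x. vnorm n (vdiff F G x)"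
  have "vLnorm n M r ?H \<le> (\<integral>x. 2 powr r * ?d x powr p \<partial>M) powr (1 / r)"
  proof (rule vLnorm_mono)
    fix x
    have "vnorm n (?H x) powr r \<le> (2 * ?d x powr (s + 1)) powr r"
      using pow_map_diff_neg_exponent[OF s, of n "F x" "G x"] r
      by (intro powr_mono2) (auto simp: vdiff_def)
    then show "vnorm n (?H x) powr r \<le> 2 powr r * ?d x powr p"
      using r by (simp add: powr_mult powr_powr mult.commute)
  qed (use r vLp_integrable[OF vLp_vdiff[OF F G p]] in auto)
  also have "\<dots> = 2 * vLnorm n M p (vdiff F G) powr (s + 1)"
    using r s by (simp add: powr_mult powr_powr vLnorm_eq)
  finally show ?thesis
    by (simp add: r_def)
qed

text \<open>For negative s the map is Hoelder continuous and the limit is immediate. For s at least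
  0 it is only Lipschitz on bounded sets, and boundedness of the norms is extracted from the
  convergence first.\<close>

lemma vLp_tendsto_pow_map:
  assumes lim: "vLp_tendsto n M p F G" and p: "1 \<le> p" and s: "-1 < s"
  shows "vLp_tendsto n M (p / (s + 1)) (\<lambda>j x. pow_map n s (F j x)) (\<lambda>x. pow_map n s (G x))"
proof -
  have F: "F j \<in> vLp n M p" and G: "G \<in> vLp n M p" for j
    using lim by (auto simp: vLp_tendsto_def)
  define e where "e j = vLnorm n M p (vdiff (F j) G)" for j
  have e: "e \<longlonglongrightarrow> 0" "\<And>j. 0 \<le> e j"
    using lim by (auto simp: vLp_tendsto_def e_def[abs_def])
  let ?l = "\<lambda>j. vLnorm n M (p / (s + 1))
    (vdiff (\<lambda>x. pow_map n s (F j x)) (\<lambda>x. pow_map n s (G x)))"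
  have "?l \<longlonglongrightarrow> 0"
  proof (cases "0 \<le> s")
    case True
    obtain K where K: "\<And>j. e j \<le> K"
      using convergent_imp_Bseq[OF convergentI[OF e(1)]] e(2)
      by (auto simp: Bseq_def)
    \<comment> \<open>The Lipschitz constant with the norm of \<open>F j\<close> replaced by a bound
      uniform in j, which follows from \<open>e j \<le> K\<close>.\<close>
    define C where "C = (1 + s) * 4 powr s * (4 * (K + vLnorm n M p G) + vLnorm n M p G) powr s"
    have le: "?l j \<le> C * e j" for j
    proof -
      \<comment> \<open>The difference of 0 and G stands for the negative of G, so that
        \<open>vLnorm_vdiff_le\<close> also serves as a triangle inequality for the sum of
        \<open>F j - G\<close> and G.\<close>
      have "vdiff (vdiff (F j) G) (vdiff (\<lambda>_ _. 0) G) = F j"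
        by (simp add: vdiff_def)
      moreover have D: "vdiff (F j) G \<in> vLp n M p"
        using vLp_vdiff[OF F G] p by simp
      moreover have G': "vdiff (\<lambda>_ _. 0) G \<in> vLp n M p" "vLnorm n M p (vdiff (\<lambda>_ _. 0) G) = vLnorm n M p G"
        using G vnorm_scale[of n "-1"] by (auto simp: vLp_def vLnorm_eq vdiff_def)
      ultimately have "vLnorm n M p (F j) \<le> 4 * (e j + vLnorm n M p G)"
        using vLnorm_vdiff_le[OF D G'(1) p] by (simp add: e_def)
      then have "(vLnorm n M p (F j) + vLnorm n M p G) powr s
          \<le> (4 * (K + vLnorm n M p G) + vLnorm n M p G) powr s"
        using True K[of j] by (intro powr_mono2) auto
      then have "(1 + s) * 4 powr s * (vLnorm n M p (F j) + vLnorm n M p G) powr s * e j \<le> C * e j"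
        unfolding C_def using True e by (intro mult_right_mono mult_left_mono) auto
      then show ?thesis
        using vLnorm_pow_map_diff_nonneg_exponent[OF F[of j] G p True] by (simp add: e_def)
    qed
    show ?thesis
    proof (rule tendsto_sandwich[of "\<lambda>_. 0" _ _ "\<lambda>j. C * e j"])
      show "(\<lambda>j. C * e j) \<longlonglongrightarrow> 0"
        using tendsto_mult_right_zero[OF e(1)] by simp
    qed (use le in auto)
  next
    case False
    show ?thesis
    proof (rule tendsto_sandwich[of "\<lambda>_. 0" _ _ "\<lambda>j. 2 * e j powr (s + 1)"])
      show "\<forall>\<^sub>F j in sequentially. ?l j \<le> 2 * e j powr (s + 1)"
        using vLnorm_pow_map_diff_neg_exponent[OF F G] p s False by (simp add: e_def)
      have "(\<lambda>j. e j powr (s + 1)) \<longlonglongrightarrow> 0"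
        using e s by (intro tendsto_zero_powrI[of _ _ _ "s + 1"]) auto
      then show "(\<lambda>j. 2 * e j powr (s + 1)) \<longlonglongrightarrow> 0"
        by (rule tendsto_mult_right_zero)
    qed auto
  qed
  then show ?thesis
    using vLp_pow_map[OF _ s] F G by (simp add: vLp_tendsto_def)
qed


subsection \<open>Bump functions\<close>

text \<open>The case \<open>j = 0\<close> is the function f of the overview; the extra powers of the
  reciprocal make the linear span closed under differentiation.\<close>

definition flat :: "nat \<Rightarrow> real \<Rightarrow> real" where
  "flat j y = (if 0 < y then inverse y ^ j * exp (- inverse y) else 0)"

text \<open>Away from the origin this is the product rule. At the origin the right difference
  quotient is \<open>u ^ (j + 1) / exp u\<close> with \<open>u = inverse y\<close>, which tends to 0
  because the exponential beats every power.\<close>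

lemma flat_has_derivative:
  "(flat j has_real_derivative flat (j + 2) y - real j * flat (j + 1) y) (at y)"
proof -
  consider "y < 0" | "y = 0" | "0 < y" by linarith
  then show ?thesis
  proof cases
    case 1
    have "\<forall>\<^sub>F z in nhds y. z < 0"
      using 1 by (intro eventually_nhds_in_open[of "{..<0}", simplified]) auto
    then have "\<forall>\<^sub>F z in nhds y. flat j z = 0"
      by eventually_elim (simp add: flat_def)
    moreover have "((\<lambda>_. 0) has_real_derivative flat (j + 2) y - real j * flat (j + 1) y) (at y)"
      using 1 by (simp add: flat_def)
    ultimately show ?thesis
      by (subst DERIV_cong_ev[OF refl _ refl]) auto
  next
    case 2
    have "((\<lambda>y. inverse y ^ (j + 1) / exp (inverse y)) \<longlongrightarrow> 0) (at_right (0::real))"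
      by (rule filterlim_compose[OF tendsto_power_div_exp_0 filterlim_inverse_at_top_right])
    moreover have "\<forall>\<^sub>F y in at_right 0. inverse y ^ (j + 1) / exp (inverse y) = flat j y / y"
      using eventually_at_right_less[of "0::real"]
      by eventually_elim (simp add: flat_def exp_minus field_simps)
    ultimately have "((\<lambda>y. flat j y / y) \<longlongrightarrow> 0) (at_right 0)"
      by (rule Lim_transform_eventually)
    moreover have "((\<lambda>y. flat j y / y) \<longlongrightarrow> 0) (at_left 0)"
    proof (rule Lim_transform_eventually)
      show "\<forall>\<^sub>F y in at_left (0::real). 0 = flat j y / y"
        by (auto simp: flat_def eventually_at_left_field intro: exI[of _ "-1"])
    qed auto
    ultimately have "((\<lambda>y. flat j y / y) \<longlongrightarrow> 0) (at 0)"
      by (simp add: filterlim_at_split)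
    then show ?thesis
      using 2 by (simp add: has_field_derivative_iff flat_def)
  next
    case 3
    have "\<forall>\<^sub>F z in nhds y. 0 < z"
      using 3 by (intro eventually_nhds_in_open[of "{0<..}", simplified]) auto
    then have "\<forall>\<^sub>F z in nhds y. flat j z = inverse z ^ j * exp (- inverse z)"
      by eventually_elim (simp add: flat_def)
    moreover have "((\<lambda>z. inverse z ^ j * exp (- inverse z)) has_real_derivative
        flat (j + 2) y - real j * flat (j + 1) y) (at y)"
    proof -
      have inv: "(inverse has_real_derivative - (inverse y ^ 2)) (at y)"
        using DERIV_inverse[of y] 3 by (simp add: numeral_2_eq_2)
      have "((\<lambda>z. inverse z ^ j) has_real_derivative - (real j * inverse y ^ (j + 1))) (at y)" for j
      proof (induction j)
        case (Suc j)
        show ?case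
          using DERIV_mult[OF inv Suc] by (simp add: power2_eq_square algebra_simps)
      qed auto
      from DERIV_mult[OF this[of j] DERIV_fun_exp[OF DERIV_minus[OF inv]]] show ?thesis
        using 3 by (simp add: flat_def power2_eq_square algebra_simps)
    qed
    ultimately show ?thesis
      by (subst DERIV_cong_ev[OF refl _ refl]) auto
  qed
qed

lemma flat_0_bounds: "0 \<le> flat 0 y" "flat 0 y \<le> 1"
  by (auto simp: flat_def)

text \<open>Scaling sends positive arguments to infinity, where \<open>flat 0\<close> tends to 1,
  and keeps all others in its zero set. This is why the limit is the indicator of an open
  half-line.\<close>

lemma flat_0_tendsto: "(\<lambda>k. flat 0 (real (Suc k) * y)) \<longlonglongrightarrow> indicator {0<..} y"
proof (cases "0 < y")
  case True
  have "(\<lambda>k. exp (- (inverse y * inverse (real (Suc k))))) \<longlonglongrightarrow> exp (- (inverse y * 0))"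
    by (intro tendsto_intros LIMSEQ_inverse_real_of_nat)
  moreover have "flat 0 (real (Suc k) * y) = exp (- (inverse y * inverse (real (Suc k))))" for k
    using True by (simp add: flat_def del: of_nat_Suc)
  ultimately show ?thesis
    using True by simp
next
  case False
  then have "flat 0 (real (Suc k) * y) = 0" for k
    by (simp add: flat_def mult_less_0_iff zero_less_mult_iff del: of_nat_Suc)
  then show ?thesis
    using False by simp
qed

text \<open>The class is closed under differentiation and hence consists of smooth functions.\<close>

inductive smooth_gen :: "(real \<Rightarrow> real) \<Rightarrow> bool" where
  flat: "smooth_gen (\<lambda>t. flat j (l * t + m))"
| scale: "smooth_gen f \<Longrightarrow> smooth_gen (\<lambda>t. c * f t)"
| add: "smooth_gen f \<Longrightarrow> smooth_gen g \<Longrightarrow> smooth_gen (\<lambda>t. f t + g t)"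
| mult: "smooth_gen f \<Longrightarrow> smooth_gen g \<Longrightarrow> smooth_gen (\<lambda>t. f t * g t)"

lemma smooth_gen_has_derivative:
  "smooth_gen f \<Longrightarrow> \<exists>f'. smooth_gen f' \<and> (\<forall>x. (f has_real_derivative f' x) (at x))"
proof (induction rule: smooth_gen.induct)
  case (flat j l m)
  \<comment> \<open>The difference is written as a sum with the coefficient \<open>- real j\<close>,
    to fit the rules of the class.\<close>
  let ?f' = "\<lambda>t. l * (flat (j + 2) (l * t + m) + (- real j) * flat (j + 1) (l * t + m))"
  have "((\<lambda>t. flat j (l * t + m)) has_real_derivative ?f' x) (at x)" for x
  proof -
    have "((\<lambda>t. l * t + m) has_real_derivative l) (at x)"
      by (auto intro!: derivative_eq_intros)
    from DERIV_chain2[of "flat j" _ "\<lambda>t. l * t + m", OF flat_has_derivative this] show ?thesis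
      by (simp add: mult.commute)
  qed
  moreover have "smooth_gen ?f'"
    by (intro smooth_gen.intros)
  ultimately show ?case by blast
next
  case (scale f c)
  then obtain f' where "smooth_gen f'" "\<And>x. (f has_real_derivative f' x) (at x)"
    by blast
  then show ?case
    by (intro exI[of _ "\<lambda>t. c * f' t"]) (auto intro!: smooth_gen.intros DERIV_cmult)
next
  case (add f g)
  then obtain f' g' where "smooth_gen f'" "\<And>x. (f has_real_derivative f' x) (at x)"
    "smooth_gen g'" "\<And>x. (g has_real_derivative g' x) (at x)"
    by blast
  then show ?case
    by (intro exI[of _ "\<lambda>t. f' t + g' t"]) (auto intro!: smooth_gen.intros DERIV_add)
next
  case (mult f g)
  then obtain f' g' where "smooth_gen f'" "\<And>x. (f has_real_derivative f' x) (at x)"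
    "smooth_gen g'" "\<And>x. (g has_real_derivative g' x) (at x)"
    by blast
  then show ?case
    using mult.hyps
    by (intro exI[of _ "\<lambda>t. f' t * g t + g' t * f t"]) (auto intro!: smooth_gen.intros DERIV_mult)
qed

lemma smooth_gen_deriv:
  assumes "smooth_gen f"
  shows "smooth_gen (deriv f)" "(f has_real_derivative deriv f x) (at x)"
proof -
  obtain f' where f': "smooth_gen f'" "\<And>x. (f has_real_derivative f' x) (at x)"
    using smooth_gen_has_derivative[OF assms] by blast
  then have "deriv f = f'"
    by (auto simp: DERIV_imp_deriv)
  then show "smooth_gen (deriv f)" "(f has_real_derivative deriv f x) (at x)"
    using f' by auto
qed

lemma smooth_gen_continuous: "smooth_gen f \<Longrightarrow> continuous_on A f"
  by (meson DERIV_isCont continuous_at_imp_continuous_on smooth_gen_deriv(2))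

text \<open>A partial derivative replaces one factor by its derivative and leaves a product of the
  same kind; hence the induction on k over all families h.\<close>

lemma Ck_prod:
  fixes h :: "nat \<Rightarrow> real \<Rightarrow> real"
  assumes "\<And>i. smooth_gen (h i)"
  shows "Ck n k (\<lambda>x. \<Prod>i<n. h i (x i))"
  using assms
proof (induction k arbitrary: h)
  case 0
  have "continuous_on (Rn n) (\<lambda>x. h i (x i))" for i
    using smooth_gen_continuous[OF 0]
    by (intro continuous_on_compose2[of UNIV "h i" _ "\<lambda>x. x i"]
        continuous_on_subset[OF continuous_on_product_coordinates]) auto
  then show ?case
    by (auto intro: continuous_on_prod)
next
  case (Suc k)
  have split: "(\<Prod>j<n. g j ((x(i := t)) j)) = g i t * (\<Prod>j\<in>{..<n}-{i}. g j (x j))"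
    if "i < n" for i and g :: "nat \<Rightarrow> real \<Rightarrow> real" and x :: vec and t :: real
    using that by (subst prod.remove[of _ i]) (auto intro!: prod.cong)
  have der: "((\<lambda>t. \<Prod>j<n. h j ((x(i := t)) j)) has_real_derivative
      (\<Prod>j<n. (h(i := deriv (h i))) j ((x(i := t)) j))) (at t)" if i: "i < n" for i x t
    unfolding split[OF i]
    using DERIV_cmult_right[OF smooth_gen_deriv(2)[OF Suc.prems, of i t],
        of "\<Prod>j\<in>{..<n}-{i}. h j (x j)"]
    by simp
  have "partial i (\<lambda>x. \<Prod>j<n. h j (x j)) = (\<lambda>x. \<Prod>j<n. (h(i := deriv (h i))) j (x j))"
    if "i < n" for i
  proof
    fix x :: vec
    show "partial i (\<lambda>x. \<Prod>j<n. h j (x j)) x = (\<Prod>j<n. (h(i := deriv (h i))) j (x j))"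
      unfolding partial_def using DERIV_imp_deriv[OF der[OF that, of x "x i"]] by simp
  qed
  moreover have "Ck n k (\<lambda>x. \<Prod>j<n. (h(i := deriv (h i))) j (x j))" for i
    using Suc.prems smooth_gen_deriv(1) by (intro Suc.IH) auto
  moreover have "(\<lambda>t. \<Prod>j<n. h j ((x(i := t)) j)) differentiable at (x i)" if "i < n" for i x
    using der[OF that] real_differentiable_def by blast
  moreover have "continuous_on (Rn n) (\<lambda>x. \<Prod>j<n. h j (x j))"
    using Suc.IH[OF Suc.prems] by (cases k) auto
  ultimately show ?case
    by simp
qed

section \<open>Cells and their bump functions\<close>

text \<open>Open cells arise as limits of bump functions, the closed ones below as compact sets
  outside which these vanish.\<close>

definition cell :: "nat \<Rightarrow> vec \<Rightarrow> vec \<Rightarrow> vec set" where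
  "cell n c d = (\<Pi>\<^sub>E i\<in>{..<n}. {c i<..<d i})"

definition ccell :: "nat \<Rightarrow> vec \<Rightarrow> vec \<Rightarrow> vec set" where
  "ccell n c d = (\<Pi>\<^sub>E i\<in>{..<n}. {c i..d i})"

lemma cell_subset_ccell: "cell n c d \<subseteq> ccell n c d"
  unfolding cell_def ccell_def by (intro PiE_mono) auto

lemma ccell_subset_Rn: "ccell n c d \<subseteq> Rn n"
  unfolding ccell_def Rn_def by (intro PiE_mono) auto

text \<open>Coordinates from n on are pinned to \<open>undefined\<close>, so the set is a product of
  compact sets over all indices and Tychonoff's theorem applies.\<close>

lemma compact_ccell: "compact (ccell n c d)"
proof -
  have "ccell n c d = (\<Pi>\<^sub>E i\<in>UNIV. if i < n then {c i..d i} else {undefined})"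
    by (auto simp: ccell_def PiE_def Pi_def extensional_def split: if_splits)
  moreover have "compactin (product_topology (\<lambda>_. euclidean) UNIV)
      (\<Pi>\<^sub>E i\<in>UNIV. if i < n then {c i..d i} else {undefined})"
    by (subst compactin_PiE) auto
  ultimately show ?thesis
    by (simp add: euclidean_product_topology)
qed

definition bump :: "nat \<Rightarrow> vec \<Rightarrow> vec \<Rightarrow> nat \<Rightarrow> vec \<Rightarrow> real" where
  "bump n c d k x =
     (\<Prod>i<n. flat 0 (real (Suc k) * (x i - c i)) * flat 0 (real (Suc k) * (d i - x i)))"

lemma bump_eq_0:
  assumes "x \<in> Rn n" "x \<notin> ccell n c d"
  shows "bump n c d k x = 0"
proof -
  obtain i where i: "i < n" "x i < c i \<or> d i < x i"
    using assms by (auto simp: Rn_def ccell_def PiE_def Pi_def not_le)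
  then have "real (Suc k) * (x i - c i) \<le> 0 \<or> real (Suc k) * (d i - x i) \<le> 0"
    by (auto simp: mult_le_0_iff simp del: of_nat_Suc)
  then show ?thesis
    unfolding bump_def using i by (intro prod_zero) (auto simp: flat_def not_less intro!: bexI[of _ i])
qed

lemma bump_bounds: "0 \<le> bump n c d k x" "bump n c d k x \<le> 1"
  unfolding bump_def using flat_0_bounds
  by (auto intro!: prod_nonneg prod_le_1 mult_le_one simp del: of_nat_Suc)

lemma bump_tendsto:
  assumes "x \<in> Rn n"
  shows "(\<lambda>k. bump n c d k x) \<longlonglongrightarrow> indicator (cell n c d) x"
proof -
  have "(\<lambda>k. bump n c d k x) \<longlonglongrightarrow> (\<Prod>i<n. indicator {0<..} (x i - c i) * indicator {0<..} (d i - x i))"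
    unfolding bump_def by (intro tendsto_prod tendsto_mult flat_0_tendsto)
  also have "(\<Prod>i<n. indicator {0<..} (x i - c i) * indicator {0<..} (d i - x i)) = (indicator (cell n c d) x :: real)"
  proof (cases "x \<in> cell n c d")
    case True
    then show ?thesis
      by (auto simp: cell_def PiE_def Pi_def intro!: prod.neutral)
  next
    case False
    then obtain i where "i < n" "\<not> (c i < x i \<and> x i < d i)"
      using assms by (auto simp: cell_def Rn_def PiE_def Pi_def)
    then have "(\<Prod>i<n. indicator {0<..} (x i - c i) * indicator {0<..} (d i - x i)) = (0::real)"
      by (intro prod_zero) (auto intro!: bexI[of _ i] simp: indicator_def)
    then show ?thesis using False by simp
  qed
  finally show ?thesis .
qed

lemma bump_in_Cc_inf:
  assumes "ccell n c d \<subseteq> D"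
  shows "bump n c d k \<in> Cc_inf n D"
proof -
  have "smooth_gen (\<lambda>t. flat 0 (real (Suc k) * (t - c i)) * flat 0 (real (Suc k) * (d i - t)))" for i
    using smooth_gen.mult[OF smooth_gen.flat[of 0 "real (Suc k)" "- real (Suc k) * c i"]
        smooth_gen.flat[of 0 "- real (Suc k)" "real (Suc k) * d i"]]
    by (simp add: algebra_simps)
  then have "Ck n m (bump n c d k)" for m
    unfolding bump_def[abs_def]
    by (rule Ck_prod[of "\<lambda>i t. flat 0 (real (Suc k) * (t - c i)) * flat 0 (real (Suc k) * (d i - t))"])
  then show ?thesis
    using assms compact_ccell[of n c d] bump_eq_0[of _ n c d k]
    by (auto simp: Cc_inf_def intro!: exI[of _ "ccell n c d"])
qed


subsection \<open>Fundamental lemma of the calculus of variations\<close>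

abbreviation prod_lborel :: "nat \<Rightarrow> vec measure" where
  "prod_lborel n \<equiv> Pi\<^sub>M {..<n} (\<lambda>_. lborel)"

section \<open>Topology and product sigma-algebra\<close>

lemma space_prod_lborel: "space (prod_lborel n) = Rn n"
  by (simp add: space_PiM Rn_def)

text \<open>Links the sigma-algebra of n factors with the Borel sets of the topology on functions of
  all indices: the coordinates from n on are constant on \<open>Rn n\<close>, hence
  measurable.\<close>

lemma prod_lborel_measurable_ident:
  "(\<lambda>x. x) \<in> prod_lborel n \<rightarrow>\<^sub>M restrict_space borel (Rn n)"
proof (rule measurable_restrict_space2)
  show "(\<lambda>x. x) \<in> borel_measurable (prod_lborel n)"
  proof (rule measurable_coordinatewise_then_product)
    fix i
    show "(\<lambda>x. x i) \<in> borel_measurable (prod_lborel n)"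
    proof (cases "i < n")
      case True
      then show ?thesis
        using measurable_component_singleton[of i "{..<n}" "\<lambda>_. lborel"] by simp
    next
      case False
      have "(\<lambda>x. undefined) \<in> borel_measurable (prod_lborel n)"
        by simp
      then show ?thesis
        by (rule measurable_cong[THEN iffD1, rotated])
          (use False in \<open>auto simp: space_PiM PiE_def extensional_def\<close>)
    qed
  qed
qed (simp add: space_prod_lborel)

lemma continuous_on_Rn_measurable:
  assumes "continuous_on (Rn n) f"
  shows "(f :: vec \<Rightarrow> real) \<in> borel_measurable (prod_lborel n)"
  using measurable_compose[OF prod_lborel_measurable_ident
      borel_measurable_continuous_on_restrict[OF assms]] .

lemma borel_Int_Rn_sets:
  assumes "B \<in> sets borel"
  shows "B \<inter> Rn n \<in> sets (prod_lborel n)"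
  using measurable_sets[OF prod_lborel_measurable_ident, of "B \<inter> Rn n" n] assms
  by (simp add: sets_restrict_space space_prod_lborel inf_commute inf_left_commute)

lemma openin_Rn_sets:
  assumes "openin (top_of_set (Rn n)) D"
  shows "D \<in> sets (prod_lborel n)" "D \<subseteq> Rn n"
  using assms borel_Int_Rn_sets[OF borel_open] by (auto simp: openin_open Int_commute)

lemma compact_Rn_sets:
  assumes "compact K" "K \<subseteq> Rn n"
  shows "K \<in> sets (prod_lborel n)"
  using borel_Int_Rn_sets[of K n] assms by (simp add: borel_compact Int_absorb2)

text \<open>Orthants are stable under intersection, as Dynkin's theorem requires later. They
  generate the product because half-lines generate the Borel sets of each factor and countably many
  of them cover the line.\<close>

lemma sets_prod_lborel:
  "sets (prod_lborel n) = sigma_sets (Rn n) (range (\<lambda>a. \<Pi>\<^sub>E i\<in>{..<n}. {..<a i}))"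
proof -
  let ?P = "{{f \<in> (\<Pi>\<^sub>E i\<in>{..<n}. UNIV). \<forall>i\<in>j. f i \<in> A i} | A j.
      j \<in> {{..<n}} \<and> A \<in> (\<Pi> i\<in>j. range lessThan)} :: vec set set"
  have "sets (prod_lborel n) = sets (\<Pi>\<^sub>M i\<in>{..<n}. sigma UNIV (range (lessThan :: real \<Rightarrow> _)))"
    by (intro sets_PiM_cong) (auto simp: borel_Iio[symmetric])
  also have "\<dots> = sets (sigma (\<Pi>\<^sub>E i\<in>{..<n}. UNIV) ?P)"
  proof (rule sets_PiM_sigma)
    have "UNIV = (\<Union>k::nat. {..<real k})"
      by (auto simp: reals_Archimedean2)
    then show "\<exists>S\<subseteq>range lessThan. countable S \<and> (UNIV :: real set) = \<Union> S" for i :: nat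
      by (intro exI[of _ "range (\<lambda>k::nat. {..<real k})"]) auto
  qed auto
  also have "\<dots> = sigma_sets (Rn n) ?P"
    by (subst sets_measure_of) (auto simp: Rn_def)
  also have "?P = range (\<lambda>a. \<Pi>\<^sub>E i\<in>{..<n}. {..<a i})"
  proof (intro equalityI subsetI)
    fix X :: "vec set" assume "X \<in> ?P"
    then obtain A j where "X = {f \<in> (\<Pi>\<^sub>E i\<in>{..<n}. UNIV). \<forall>i\<in>j. f i \<in> A i}"
      and "j \<in> {{..<n}}" and A: "A \<in> (\<Pi> i\<in>j. range lessThan)"
      by (elim CollectE exE conjE)
    then have X: "X = {f \<in> (\<Pi>\<^sub>E i\<in>{..<n}. UNIV). \<forall>i\<in>{..<n}. f i \<in> A i}" and j: "j = {..<n}"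
      by simp_all
    have "\<exists>a. A i = {..<a}" if "i < n" for i
      using Pi_mem[OF A, of i] that j by auto
    then obtain a where "\<forall>i<n. A i = {..<a i}"
      by metis
    then have "X = (\<Pi>\<^sub>E i\<in>{..<n}. {..<a i})"
      unfolding X by (auto simp: PiE_def Pi_def)
    then show "X \<in> range (\<lambda>a. \<Pi>\<^sub>E i\<in>{..<n}. {..<a i})"
      by simp
  next
    fix X :: "vec set" assume "X \<in> range (\<lambda>a. \<Pi>\<^sub>E i\<in>{..<n}. {..<a i})"
    then obtain a where "X = (\<Pi>\<^sub>E i\<in>{..<n}. {..<a i})" by auto
    then show "X \<in> ?P"
      by (intro CollectI exI[of _ "\<lambda>i. {..<a i}"] exI[of _ "{..<n}"]) (auto simp: PiE_def Pi_def)
  qed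
  finally show ?thesis .
qed

lemma leb_on_sets:
  assumes "D \<in> sets (prod_lborel n)"
  shows "D \<inter> space (completion (prod_lborel n)) \<in> sets (completion (prod_lborel n))"
  using assms by (auto intro: sets_completionI_sets)

lemma cell_sets: "cell n c d \<in> sets (prod_lborel n)"
  unfolding cell_def by (intro sets_PiM_I_finite) auto

text \<open>An orthant meets the fixed cell in a cell with the same lower corner and a smaller upper
  one. Thus g cut off to the cell has integral zero over all orthants, by Dynkin's theorem over all
  measurable sets, and uniqueness of densities makes it zero almost everywhere.\<close>

lemma AE_zero_if_cell_integrals_zero:
  fixes g :: "vec \<Rightarrow> real"
  assumes int: "integrable (completion (prod_lborel n)) (\<lambda>x. indicator (cell n c d) x * g x)"
    and zero: "\<And>d'. (\<And>i. d' i \<le> d i) \<Longrightarrow>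
      (\<integral>x. indicator (cell n c d') x * g x \<partial>completion (prod_lborel n)) = 0"
  shows "AE x in completion (prod_lborel n). x \<in> cell n c d \<longrightarrow> g x = 0"
proof -
  let ?P = "prod_lborel n" and ?L = "completion (prod_lborel n)"
  \<comment> \<open>Orthants generate only the uncompleted sigma-algebra, so the argument runs with
    a version measurable for it.\<close>
  obtain g' where g' [measurable]: "g' \<in> borel_measurable ?P"
    and ae: "AE x in ?P. indicator (cell n c d) x * g x = g' x"
    using completion_ex_borel_measurable_real borel_measurable_integrable[OF int] by blast
  have aeL: "AE x in ?L. indicator (cell n c d) x * g x = g' x"
    using ae by (rule AE_completion)
  have [measurable]: "g' \<in> borel_measurable ?L"
    by (rule measurable_completion) fact
  have intL: "integrable ?L g'"
    using integrable_cong_AE_imp[OF int _ aeL] by simp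
  then have int': "integrable ?P g'"
    by (simp add: integrable_completion)
  have set_int: "set_integrable ?P A g'" if "A \<in> sets ?P" for A
    unfolding set_integrable_def using int' that by (intro integrable_mult_indicator)
  have half: "(LINT x:(\<Pi>\<^sub>E i\<in>{..<n}. {..<a i})|?P. g' x) = 0" for a
  proof -
    let ?A = "\<Pi>\<^sub>E i\<in>{..<n}. {..<a i}"
    have A [measurable]: "?A \<in> sets ?P"
      by (intro sets_PiM_I_finite) auto
    have AL [measurable]: "?A \<in> sets ?L"
      using A by (rule sets_completionI_sets)
    have m: "(\<lambda>x. indicator (cell n c d) x * g x) \<in> borel_measurable ?L"
      using int by simp
    have cell_eq: "cell n c (\<lambda>i. min (a i) (d i)) = ?A \<inter> cell n c d"
      by (auto simp: cell_def PiE_def Pi_def)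
    have "(LINT x:?A|?P. g' x) = (\<integral>x. indicator ?A x * g' x \<partial>?L)"
      unfolding set_lebesgue_integral_def by (subst integral_completion) auto
    also have "\<dots> = (\<integral>x. indicator ?A x * (indicator (cell n c d) x * g x) \<partial>?L)"
      using aeL m by (intro integral_cong_AE) auto
    also have "\<dots> = (\<integral>x. indicator (cell n c (\<lambda>i. min (a i) (d i))) x * g x \<partial>?L)"
      unfolding cell_eq by (simp add: indicator_inter_arith mult.assoc)
    also have "\<dots> = 0"
      by (rule zero) simp
    finally show ?thesis .
  qed
  \<comment> \<open>The complement case of the Dynkin induction subtracts from this integral over
    the whole space.\<close>
  have total: "(LINT x|?P. g' x) = 0"
  proof -
    have "(LINT x|?P. g' x) = (\<integral>x. g' x \<partial>?L)"
      by (simp add: integral_completion)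
    also have "\<dots> = (\<integral>x. indicator (cell n c d) x * g x \<partial>?L)"
      using aeL int by (intro integral_cong_AE) auto
    also have "\<dots> = 0"
      by (rule zero) simp
    finally show ?thesis .
  qed
  have "(LINT x:A|?P. g' x) = 0" if "A \<in> sets ?P" for A
  proof -
    let ?E = "range (\<lambda>a. \<Pi>\<^sub>E i\<in>{..<n}. {..<a i}) :: vec set set"
    have stable: "Int_stable ?E"
    proof (rule Int_stableI_image)
      fix a b :: vec
      show "\<exists>c\<in>UNIV. (\<Pi>\<^sub>E i\<in>{..<n}. {..<a i}) \<inter> (\<Pi>\<^sub>E i\<in>{..<n}. {..<b i}) = (\<Pi>\<^sub>E i\<in>{..<n}. {..<c i})"
        by (intro bexI[of _ "\<lambda>i. min (a i) (b i)"]) (auto simp: PiE_def Pi_def)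
    qed
    have sub: "?E \<subseteq> Pow (Rn n)"
      by (auto simp: Rn_def PiE_def)
    from that have "A \<in> sigma_sets (Rn n) ?E"
      by (simp add: sets_prod_lborel)
    with stable sub show ?thesis
    proof (induction rule: sigma_sets_induct_disjoint)
      case (basic A)
      then show ?case using half by auto
    next
      case (compl A)
      then have A: "A \<in> sets ?P"
        by (simp add: sets_prod_lborel)
      have "(LINT x:Rn n - A|?P. g' x) = (LINT x|?P. g' x - indicator A x * g' x)"
        unfolding set_lebesgue_integral_def
        by (intro Bochner_Integration.integral_cong) (auto simp: space_prod_lborel indicator_def)
      also have "\<dots> = 0"
        using total compl(2) int' set_int[OF A]
        by (simp add: set_integrable_def set_lebesgue_integral_def)
      finally show ?case .
    next
      case (union A)
      then have "\<And>i. A i \<in> sets ?P"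
        by (auto simp: sets_prod_lborel)
      then show ?case
        using union by (subst lebesgue_integral_countable_add) (auto simp: disjoint_family_on_def intro!: set_int)
    qed (simp add: set_lebesgue_integral_def)
  qed
  then have "AE x in ?P. g' x = 0"
    using density_unique_real[OF int', of "\<lambda>_. 0"] by simp
  then have "AE x in ?L. g' x = 0"
    by (rule AE_completion)
  with aeL show ?thesis
    by eventually_elim (auto simp: indicator_def)
qed

text \<open>A basic open box constrains finitely or infinitely indexed coordinates alike through its
  sides; those from n on are harmless, because points of \<open>Rn n\<close> agree there. Rational
  corners keep the family of cells countable.\<close>

lemma cell_cover:
  assumes D: "openin (top_of_set (Rn n)) D" and x: "x \<in> D"
  obtains c d where "c \<in> {..<n} \<rightarrow>\<^sub>E \<rat>" "d \<in> {..<n} \<rightarrow>\<^sub>E \<rat>" "x \<in> cell n c d" "ccell n c d \<subseteq> D"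
proof -
  obtain U where U: "open U" "D = Rn n \<inter> U"
    using D by (auto simp: openin_open)
  have "openin (product_topology (\<lambda>_. euclidean) UNIV) U"
    using U(1) by (simp add: euclidean_product_topology)
  then obtain X where X: "x \<in> (\<Pi>\<^sub>E i\<in>UNIV. X i)" "\<And>i. open (X i)" "(\<Pi>\<^sub>E i\<in>UNIV. X i) \<subseteq> U"
    using product_topology_open_contains_basis[of "\<lambda>_. euclidean" UNIV U x] U x
    by (metis IntD2 open_openin)
  have "\<exists>a\<in>\<rat>. \<exists>b\<in>\<rat>. a < x i \<and> x i < b \<and> {a..b} \<subseteq> X i" for i
  proof -
    have "x i \<in> X i"
      using X(1) by auto
    then obtain e where e: "e > 0" "cball (x i) e \<subseteq> X i"
      using X(2) open_contains_cball by blast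
    obtain a where a: "a \<in> \<rat>" "x i - e < a" "a < x i"
      using Rats_dense_in_real[of "x i - e" "x i"] e by auto
    obtain b where b: "b \<in> \<rat>" "x i < b" "b < x i + e"
      using Rats_dense_in_real[of "x i" "x i + e"] e by auto
    have "{a..b} \<subseteq> cball (x i) e"
      using a b by (auto simp: dist_real_def)
    then show ?thesis
      using a b e by blast
  qed
  then obtain a b where ab: "\<And>i. a i \<in> \<rat>" "\<And>i. b i \<in> \<rat>" "\<And>i. a i < x i" "\<And>i. x i < b i"
      "\<And>i. {a i..b i} \<subseteq> X i"
    by metis
  have xR: "x \<in> Rn n"
    using x U by auto
  show thesis
  \<comment> \<open>Cutting the corners off at n places them in a countable set of extensional
    functions.\<close>
  proof (rule that[of "restrict a {..<n}" "restrict b {..<n}"])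
    show "x \<in> cell n (restrict a {..<n}) (restrict b {..<n})"
      using xR ab by (auto simp: cell_def Rn_def PiE_def)
    have "y \<in> (\<Pi>\<^sub>E i\<in>UNIV. X i)" if y: "y \<in> ccell n (restrict a {..<n}) (restrict b {..<n})" for y
    proof -
      have "y i \<in> X i" for i
      proof (cases "i < n")
        case True
        then have "y i \<in> {a i..b i}"
          using y by (auto simp: ccell_def PiE_def Pi_def)
        then show ?thesis using ab(5) by blast
      next
        case False
        then have "y i = x i"
          using y xR by (auto simp: ccell_def Rn_def PiE_def extensional_def)
        then show ?thesis using X(1) by auto
      qed
      then show ?thesis by auto
    qed
    then show "ccell n (restrict a {..<n}) (restrict b {..<n}) \<subseteq> D"
      using X(3) U ccell_subset_Rn by blast
  qed (use ab in auto)
qed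

lemma integrable_leb_on_iff:
  fixes f :: "vec \<Rightarrow> real"
  assumes "D \<in> sets (prod_lborel n)"
  shows "integrable (leb_on n D) f \<longleftrightarrow> integrable (completion (prod_lborel n)) (\<lambda>x. indicator D x * f x)"
  unfolding leb_on_def using integrable_restrict_space[OF leb_on_sets[OF assms], of f] by simp

lemma integral_leb_on:
  fixes f :: "vec \<Rightarrow> real"
  assumes "D \<in> sets (prod_lborel n)"
  shows "(\<integral>x. f x \<partial>leb_on n D) = (\<integral>x. indicator D x * f x \<partial>completion (prod_lborel n))"
  unfolding leb_on_def using integral_restrict_space[OF leb_on_sets[OF assms], of f] by simp

text \<open>Bump functions converge to the indicator of an open cell, dominated by 1 on the closed
  cell, where g is integrable. So g has integral zero over each open cell whose closed cell lies in
  D, and countably many of these cover D.\<close>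

lemma fundamental_lemma_calculus_of_variations:
  fixes g :: "vec \<Rightarrow> real"
  assumes D: "openin (top_of_set (Rn n)) D" and g: "loc_integrable n D g"
    and zero: "\<And>\<phi>. \<phi> \<in> Cc_inf n D \<Longrightarrow> (\<integral>x. g x * \<phi> x \<partial>leb_on n D) = 0"
  shows "AE x in leb_on n D. g x = 0"
proof -
  let ?L = "completion (prod_lborel n)"
  note Ds = openin_Rn_sets[OF D]
  have intK: "integrable ?L (\<lambda>x. indicator (ccell n c d) x * g x)" if "ccell n c d \<subseteq> D" for c d
    using g that compact_ccell[of n c d]
      integrable_leb_on_iff[OF compact_Rn_sets[OF compact_ccell[of n c d] ccell_subset_Rn], of g]
    unfolding loc_integrable_def by blast
  have ind: "indicator (cell n c d) x * (indicator (ccell n c d) x * g x) = indicator (cell n c d) x * g x"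
    for c d x
    using cell_subset_ccell[of n c d] by (auto simp: indicator_def)
  have mcell [measurable]: "cell n c d \<in> sets ?L" for c d
    using cell_sets by (rule sets_completionI_sets)
  have cell0: "(\<integral>x. indicator (cell n c d) x * g x \<partial>?L) = 0" if sub: "ccell n c d \<subseteq> D" for c d
  proof -
    let ?h = "\<lambda>x. indicator (ccell n c d) x * g x"
    have [measurable]: "bump n c d k \<in> borel_measurable ?L" for k
      using bump_in_Cc_inf[OF sub, of k]
      by (intro measurable_completion continuous_on_Rn_measurable)
        (auto simp: Cc_inf_def dest: spec[of _ 0])
    have [measurable]: "?h \<in> borel_measurable ?L"
      using intK[OF sub] by simp
    have "(\<integral>x. ?h x * bump n c d k x \<partial>?L) = 0" for k
    proof -
      have "0 = (\<integral>x. indicator D x * (g x * bump n c d k x) \<partial>?L)"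
        using zero[OF bump_in_Cc_inf[OF sub]] integral_leb_on[OF Ds(1)] by simp
      also have "\<dots> = (\<integral>x. ?h x * bump n c d k x \<partial>?L)"
        using sub bump_eq_0[of _ n c d k]
        by (intro Bochner_Integration.integral_cong) (auto simp: indicator_def space_prod_lborel)
      finally show ?thesis by simp
    qed
    moreover have "(\<lambda>k. \<integral>x. ?h x * bump n c d k x \<partial>?L)
        \<longlonglongrightarrow> (\<integral>x. ?h x * indicator (cell n c d) x \<partial>?L)"
    proof (rule integral_dominated_convergence[where w = "\<lambda>x. \<bar>?h x\<bar>"])
      show "AE x in ?L. (\<lambda>k. ?h x * bump n c d k x) \<longlonglongrightarrow> ?h x * indicator (cell n c d) x"
        by (intro AE_I2 tendsto_intros bump_tendsto) (simp add: space_prod_lborel)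
      show "AE x in ?L. norm (?h x * bump n c d k x) \<le> \<bar>?h x\<bar>" for k
        using bump_bounds[of n c d k] by (intro AE_I2) (simp add: abs_mult mult_left_le)
    qed (use intK[OF sub] in auto)
    ultimately have "(\<lambda>k. 0) \<longlonglongrightarrow> (\<integral>x. ?h x * indicator (cell n c d) x \<partial>?L)"
      by (simp only:)
    moreover have "?h x * indicator (cell n c d) x = indicator (cell n c d) x * g x" for x
      using ind[of c d x] by (simp only: mult_ac)
    ultimately have "(\<lambda>k. 0) \<longlonglongrightarrow> (\<integral>x. indicator (cell n c d) x * g x \<partial>?L)"
      by (simp only:)
    then show ?thesis
      by (simp add: LIMSEQ_const_iff)
  qed
  have cellAE: "AE x in ?L. x \<in> cell n c d \<longrightarrow> g x = 0" if sub: "ccell n c d \<subseteq> D" for c d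
  proof (rule AE_zero_if_cell_integrals_zero)
    show "integrable ?L (\<lambda>x. indicator (cell n c d) x * g x)"
      using integrable_mult_indicator[OF mcell[of c d] intK[OF sub]]
      by (simp only: real_scaleR_def ind)
    fix d' assume "\<And>i. d' i \<le> d i"
    then have "ccell n c d' \<subseteq> ccell n c d"
      unfolding ccell_def by (intro PiE_mono) auto
    then show "(\<integral>x. indicator (cell n c d') x * g x \<partial>?L) = 0"
      using sub by (intro cell0) auto
  qed
  define S where "S = {(c, d). c \<in> ({..<n} \<rightarrow>\<^sub>E \<rat>) \<and> d \<in> ({..<n} \<rightarrow>\<^sub>E \<rat>) \<and> ccell n c d \<subseteq> D}"
  have "countable (({..<n} \<rightarrow>\<^sub>E \<rat>) \<times> ({..<n} \<rightarrow>\<^sub>E (\<rat> :: real set)))"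
    by (intro countable_SIGMA countable_PiE) (auto simp: countable_rat)
  then have S: "countable S"
    by (rule countable_subset[rotated]) (auto simp: S_def)
  have "AE x in ?L. x \<in> cell n (fst cd) (snd cd) \<longrightarrow> g x = 0" if "cd \<in> S" for cd
    using that by (intro cellAE) (simp add: S_def case_prod_beta)
  then have "AE x in ?L. \<forall>cd\<in>S. x \<in> cell n (fst cd) (snd cd) \<longrightarrow> g x = 0"
    using AE_ball_countable'[where P = "\<lambda>cd x. x \<in> cell n (fst cd) (snd cd) \<longrightarrow> g x = 0", OF _ S]
    by simp
  then have "AE x in ?L. x \<in> D \<longrightarrow> g x = 0"
  proof eventually_elim
    case (elim x)
    show ?case
    proof
      assume "x \<in> D"
      from cell_cover[OF D this] obtain c d where cd: "c \<in> {..<n} \<rightarrow>\<^sub>E \<rat>" "d \<in> {..<n} \<rightarrow>\<^sub>E \<rat>"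
        "x \<in> cell n c d" "ccell n c d \<subseteq> D" .
      then have "(c, d) \<in> S"
        by (simp add: S_def)
      from bspec[OF elim this] cd(3) show "g x = 0"
        by simp
    qed
  qed
  then show ?thesis
    unfolding leb_on_def by (subst AE_restrict_space_iff[OF leb_on_sets[OF Ds(1)]])
qed

text \<open>Completeness of the measure: changing a function on a null set preserves measurability.
  This lets an arbitrarily chosen weak gradient inherit measurability from another one.\<close>

lemma leb_on_measurable_AE:
  fixes f g :: "vec \<Rightarrow> real"
  assumes D: "D \<in> sets (prod_lborel n)" and f: "f \<in> borel_measurable (leb_on n D)"
    and ae: "AE x in leb_on n D. f x = g x"
  shows "g \<in> borel_measurable (leb_on n D)"
proof -
  let ?L = "completion (prod_lborel n)"
  note Ds = leb_on_sets[OF D]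
  have f': "(\<lambda>x. indicator D x * f x) \<in> borel_measurable ?L"
    using f borel_measurable_restrict_space_iff[OF Ds, of f] by (simp add: leb_on_def)
  have ae': "AE x in ?L. indicator D x * f x = indicator D x * g x"
    using ae unfolding leb_on_def AE_restrict_space_iff[OF Ds]
    by eventually_elim (auto simp: indicator_def)
  have "(\<lambda>x. indicator D x * g x) \<in> borel_measurable ?L"
  proof (rule measurableI)
    fix A :: "real set" assume A: "A \<in> sets borel"
    show "(\<lambda>x. indicator D x * g x) -` A \<inter> space ?L \<in> sets ?L"
    proof (rule completion.in_sets_AE)
      show "(\<lambda>x. indicator D x * f x) -` A \<inter> space ?L \<in> sets ?L"
        using f' A by (rule measurable_sets)
      show "AE x in ?L. x \<in> (\<lambda>x. indicator D x * f x) -` A \<inter> space ?L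
          \<longleftrightarrow> x \<in> (\<lambda>x. indicator D x * g x) -` A \<inter> space ?L"
        using ae' by eventually_elim auto
    qed auto
  qed auto
  then show ?thesis
    using borel_measurable_restrict_space_iff[OF Ds, of g] by (simp add: leb_on_def)
qed


subsection \<open>Weak gradients\<close>

text \<open>The complement of K is open and coordinate lines are continuous, so \<phi> vanishes on a
  piece of the line around the point.\<close>

lemma partial_eq_0_outside:
  assumes K: "compact K" and \<phi>: "\<And>x. x \<in> Rn n - K \<Longrightarrow> \<phi> x = 0"
    and x: "x \<in> Rn n - K" and i: "i < n"
  shows "partial i \<phi> x = 0"
proof -
  have "continuous_on UNIV (\<lambda>t. x(i := t))"
  proof (rule continuous_on_coordinatewise_then_product)
    fix j
    show "continuous_on UNIV (\<lambda>t. (x(i := t)) j)"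
      by (cases "j = i") auto
  qed
  then have "open ((\<lambda>t. x(i := t)) -` (- K))"
    using compact_imp_closed[OF K] by (intro open_vimage) auto
  then have "\<forall>\<^sub>F t in nhds (x i). t \<in> (\<lambda>t. x(i := t)) -` (- K)"
    using x by (intro eventually_nhds_in_open) auto
  then have "\<forall>\<^sub>F t in nhds (x i). \<phi> (x(i := t)) = 0"
  proof eventually_elim
    case (elim t)
    moreover have "x(i := t) \<in> Rn n"
      using x i by (auto simp: Rn_def PiE_def extensional_def)
    ultimately show ?case
      using \<phi> by auto
  qed
  then have "((\<lambda>t. \<phi> (x(i := t))) has_real_derivative 0) (at (x i))"
    by (subst DERIV_cong_ev[OF refl _ refl, of _ "\<lambda>_. 0"]) auto
  then show ?thesis
    unfolding partial_def by (rule DERIV_imp_deriv)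
qed

text \<open>The continuous factor is bounded on K, so a multiple of f cut off to K dominates the
  product.\<close>

lemma integrable_mult_compact_support:
  fixes f h :: "vec \<Rightarrow> real"
  assumes D: "openin (top_of_set (Rn n)) D" and f: "loc_integrable n D f"
    and h: "continuous_on (Rn n) h" and K: "compact K" "K \<subseteq> D" and zero: "\<And>x. x \<in> Rn n - K \<Longrightarrow> h x = 0"
  shows "integrable (leb_on n D) (\<lambda>x. f x * h x)"
proof -
  let ?L = "completion (prod_lborel n)"
  note Ds = openin_Rn_sets[OF D]
  have KR: "K \<subseteq> Rn n" using K Ds by auto
  have fK: "integrable ?L (\<lambda>x. indicator K x * f x)"
    using f K integrable_leb_on_iff[OF compact_Rn_sets[OF K(1) KR], of f]
    by (auto simp: loc_integrable_def)
  have "compact (h ` K)"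
    using continuous_on_subset[OF h KR] K(1) by (rule compact_continuous_image)
  then obtain B where B: "\<And>x. x \<in> K \<Longrightarrow> \<bar>h x\<bar> \<le> B"
    using compact_imp_bounded bounded_iff by (metis imageI real_norm_def)
  have [measurable]: "h \<in> borel_measurable ?L"
    by (intro measurable_completion continuous_on_Rn_measurable h)
  have "integrable ?L (\<lambda>x. (indicator K x * f x) * h x)"
  proof (rule Bochner_Integration.integrable_bound)
    show "integrable ?L (\<lambda>x. B * (indicator K x * f x))"
      using fK by simp
    show "(\<lambda>x. (indicator K x * f x) * h x) \<in> borel_measurable ?L"
      by (intro borel_measurable_times borel_measurable_integrable[OF fK]) measurable
    have "\<bar>f x\<bar> * \<bar>h x\<bar> \<le> \<bar>B\<bar> * \<bar>f x\<bar>" if "x \<in> K" for x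
      using mult_left_mono[OF order_trans[OF B[OF that] abs_ge_self], of "\<bar>f x\<bar>"] by (simp add: mult.commute)
    then show "AE x in ?L. norm ((indicator K x * f x) * h x) \<le> norm (B * (indicator K x * f x))"
      by (intro AE_I2) (auto simp: abs_mult indicator_def)
  qed
  moreover have "integrable ?L (\<lambda>x. (indicator K x * f x) * h x)
      \<longleftrightarrow> integrable ?L (\<lambda>x. indicator D x * (f x * h x))"
    using K zero by (intro Bochner_Integration.integrable_cong) (auto simp: space_prod_lborel indicator_def)
  ultimately show ?thesis
    by (simp add: integrable_leb_on_iff[OF Ds(1)])
qed

lemma integrable_mult_test_function:
  assumes D: "openin (top_of_set (Rn n)) D" and f: "loc_integrable n D f" and \<phi>: "\<phi> \<in> Cc_inf n D"
  shows "integrable (leb_on n D) (\<lambda>x. f x * \<phi> x)"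
    and "i < n \<Longrightarrow> integrable (leb_on n D) (\<lambda>x. f x * partial i \<phi> x)"
proof -
  obtain K where K: "compact K" "K \<subseteq> D" and zero: "\<And>x. x \<in> Rn n - K \<Longrightarrow> \<phi> x = 0"
    using \<phi> by (auto simp: Cc_inf_def)
  have C: "Ck n (Suc 0) \<phi>"
    using \<phi> unfolding Cc_inf_def by blast
  show "integrable (leb_on n D) (\<lambda>x. f x * \<phi> x)"
    using C by (intro integrable_mult_compact_support[OF D f _ K zero]) simp_all
  show "integrable (leb_on n D) (\<lambda>x. f x * partial i \<phi> x)" if "i < n"
    using C that
    by (intro integrable_mult_compact_support[OF D f _ K] partial_eq_0_outside[OF K(1) zero]) simp_all
qed

section \<open>Linearity and uniqueness of weak gradients\<close>

lemma loc_integrable_diff: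
  "loc_integrable n D f \<Longrightarrow> loc_integrable n D g \<Longrightarrow> loc_integrable n D (\<lambda>x. f x - g x)"
  by (simp add: loc_integrable_def)

text \<open>Bochner integrals may be subtracted only when both integrands are integrable, which
  \<open>integrable_mult_test_function\<close> guarantees here.\<close>

lemma is_weak_grad_diff:
  assumes D: "openin (top_of_set (Rn n)) D" and w: "is_weak_grad n D w G" and u: "is_weak_grad n D u H"
  shows "is_weak_grad n D (\<lambda>x. w x - u x) (vdiff G H)"
  unfolding is_weak_grad_def
proof (intro conjI allI impI ballI)
  show "loc_integrable n D (\<lambda>x. w x - u x)"
    using w u by (auto simp: is_weak_grad_def intro: loc_integrable_diff)
  fix i assume i: "i < n"
  show "loc_integrable n D (\<lambda>x. vdiff G H x i)"
    using w u i by (auto simp: is_weak_grad_def vdiff_def intro: loc_integrable_diff)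
  fix \<phi> assume \<phi>: "\<phi> \<in> Cc_inf n D"
  have li: "loc_integrable n D w" "loc_integrable n D u"
     "loc_integrable n D (\<lambda>x. G x i)" "loc_integrable n D (\<lambda>x. H x i)"
    using w u i by (auto simp: is_weak_grad_def)
  note int = integrable_mult_test_function[OF D _ \<phi>]
  have "(\<integral>x. (w x - u x) * partial i \<phi> x \<partial>leb_on n D)
      = (\<integral>x. w x * partial i \<phi> x \<partial>leb_on n D) - (\<integral>x. u x * partial i \<phi> x \<partial>leb_on n D)"
    using int(2)[OF li(1) i] int(2)[OF li(2) i] by (simp add: left_diff_distrib)
  also have "\<dots> = (\<integral>x. H x i * \<phi> x \<partial>leb_on n D) - (\<integral>x. G x i * \<phi> x \<partial>leb_on n D)"
    using w u i \<phi> by (simp add: is_weak_grad_def)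
  also have "\<dots> = - (\<integral>x. vdiff G H x i * \<phi> x \<partial>leb_on n D)"
    using int(1)[OF li(3)] int(1)[OF li(4)] by (simp add: left_diff_distrib vdiff_def)
  finally show "(\<integral>x. (w x - u x) * partial i \<phi> x \<partial>leb_on n D)
      = - (\<integral>x. vdiff G H x i * \<phi> x \<partial>leb_on n D)" .
qed

lemma is_weak_grad_unique:
  assumes D: "openin (top_of_set (Rn n)) D" and G: "is_weak_grad n D w G" and H: "is_weak_grad n D w H"
  shows "AE x in leb_on n D. \<forall>i<n. G x i = H x i"
proof -
  have "AE x in leb_on n D. G x i = H x i" if i: "i < n" for i
  proof -
    have li: "loc_integrable n D (\<lambda>x. G x i)" "loc_integrable n D (\<lambda>x. H x i)"
      using G H i by (auto simp: is_weak_grad_def)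
    have "AE x in leb_on n D. G x i - H x i = 0"
    proof (rule fundamental_lemma_calculus_of_variations[OF D])
      show "loc_integrable n D (\<lambda>x. G x i - H x i)"
        using li by (rule loc_integrable_diff)
      fix \<phi> assume \<phi>: "\<phi> \<in> Cc_inf n D"
      have "(\<integral>x. G x i * \<phi> x \<partial>leb_on n D) = (\<integral>x. H x i * \<phi> x \<partial>leb_on n D)"
        using G H i \<phi> by (auto simp: is_weak_grad_def)
      then show "(\<integral>x. (G x i - H x i) * \<phi> x \<partial>leb_on n D) = 0"
        using integrable_mult_test_function(1)[OF D li(1) \<phi>]
          integrable_mult_test_function(1)[OF D li(2) \<phi>]
        by (simp add: left_diff_distrib)
    qed
    then show ?thesis by simp
  qed
  then have "AE x in leb_on n D. \<forall>i\<in>{..<n}. G x i = H x i"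
    by (intro AE_ball_countable') auto
  then show ?thesis
    by (rule eventually_mono) simp
qed

lemma vLp_cong_AE:
  assumes D: "D \<in> sets (prod_lborel n)" and F: "F \<in> vLp n (leb_on n D) p"
    and ae: "AE x in leb_on n D. \<forall>i<n. F x i = G x i"
  shows "G \<in> vLp n (leb_on n D) p" "vLnorm n (leb_on n D) p G = vLnorm n (leb_on n D) p F"
proof -
  have Gm: "(\<lambda>x. G x i) \<in> borel_measurable (leb_on n D)" if "i < n" for i
  proof (rule leb_on_measurable_AE[OF D])
    show "(\<lambda>x. F x i) \<in> borel_measurable (leb_on n D)"
      using F that by (simp add: vLp_def)
    show "AE x in leb_on n D. F x i = G x i"
      using ae by eventually_elim (use that in auto)
  qed
  have [measurable]: "(\<lambda>x. vnorm n (G x)) \<in> borel_measurable (leb_on n D)"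
    "(\<lambda>x. vnorm n (F x)) \<in> borel_measurable (leb_on n D)"
    using Gm vnorm_measurable vLp_vnorm_measurable[OF F] by auto
  have ae': "AE x in leb_on n D. vnorm n (F x) powr p = vnorm n (G x) powr p"
    using ae by eventually_elim (auto simp: cong: vnorm_cong)
  have "integrable (leb_on n D) (\<lambda>x. vnorm n (G x) powr p)"
    by (rule integrable_cong_AE_imp[OF vLp_integrable[OF F]]) (use ae' in auto)
  then show "G \<in> vLp n (leb_on n D) p"
    using Gm by (simp add: vLp_def)
  have "(\<integral>x. vnorm n (G x) powr p \<partial>leb_on n D) = (\<integral>x. vnorm n (F x) powr p \<partial>leb_on n D)"
    using ae' by (intro integral_cong_AE) auto
  then show "vLnorm n (leb_on n D) p G = vLnorm n (leb_on n D) p F"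
    by (simp add: vLnorm_eq)
qed

lemma is_weak_grad_weak_grad:
  "is_weak_grad n D w G \<Longrightarrow> is_weak_grad n D w (weak_grad n D w)"
  unfolding weak_grad_def by (rule someI[of "is_weak_grad n D w"])

text \<open>Membership in \<open>W1p\<close> provides some gradient with integrable p-th power;
  uniqueness almost everywhere transfers this to the chosen one.\<close>

lemma W1p_weak_grad:
  assumes D: "openin (top_of_set (Rn n)) D" and w: "w \<in> W1p n p D"
  shows "is_weak_grad n D w (weak_grad n D w)" "weak_grad n D w \<in> vLp n (leb_on n D) p"
proof -
  obtain G where G: "G \<in> vLp n (leb_on n D) p" "is_weak_grad n D w G"
    using w by (auto simp: W1p_def)
  show *: "is_weak_grad n D w (weak_grad n D w)"
    using G(2) by (rule is_weak_grad_weak_grad)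
  show "weak_grad n D w \<in> vLp n (leb_on n D) p"
    using vLp_cong_AE(1)[OF openin_Rn_sets(1)[OF D] G(1) is_weak_grad_unique[OF D G(2) *]] .
qed

text \<open>The Sobolev norm contains the chosen gradient of the difference. By uniqueness it agrees
  almost everywhere with the difference of the chosen gradients.\<close>

lemma W1p_tendsto_weak_grad:
  assumes D: "openin (top_of_set (Rn n)) D" and lim: "W1p_tendsto n p D w u" and p: "0 < p"
  shows "vLp_tendsto n (leb_on n D) p (\<lambda>j. weak_grad n D (w j)) (weak_grad n D u)"
proof -
  have wu: "w j \<in> W1p n p D" "u \<in> W1p n p D" for j
    using lim by (auto simp: W1p_tendsto_def)
  note w = W1p_weak_grad[OF D wu(1)] and u = W1p_weak_grad[OF D wu(2)]
  let ?d = "\<lambda>j. vLnorm n (leb_on n D) p (vdiff (weak_grad n D (w j)) (weak_grad n D u))"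
  have "?d j \<le> W1p_norm n p D (\<lambda>x. w j x - u x)" for j
  proof -
    have g: "is_weak_grad n D (\<lambda>x. w j x - u x) (vdiff (weak_grad n D (w j)) (weak_grad n D u))"
      using is_weak_grad_diff[OF D w(1) u(1)] .
    have "vLnorm n (leb_on n D) p (weak_grad n D (\<lambda>x. w j x - u x)) = ?d j"
      using vLp_cong_AE(2)[OF openin_Rn_sets(1)[OF D] vLp_vdiff[OF w(2) u(2) p]
          is_weak_grad_unique[OF D g is_weak_grad_weak_grad[OF g]]] .
    then show ?thesis
      by (simp add: W1p_norm_def Lnorm_def)
  qed
  then have "?d \<longlonglongrightarrow> 0"
    using lim unfolding W1p_tendsto_def
    by (intro tendsto_sandwich[of "\<lambda>_. 0" ?d _ "\<lambda>j. W1p_norm n p D (\<lambda>x. w j x - u x)"]) auto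
  then show ?thesis
    using w(2) u(2) by (simp add: vLp_tendsto_def)
qed

text \<open>Cauchy-Schwarz at each point, then Hoelder's inequality for the lengths.\<close>

lemma vLp_pairing:
  assumes pq: "1 < p" "1 < q" "1 / p + 1 / q = 1"
    and F: "F \<in> vLp n M p" and G: "G \<in> vLp n M q"
  shows "integrable M (\<lambda>x. \<Sum>i<n. F x i * G x i)"
    and "\<bar>\<integral>x. (\<Sum>i<n. F x i * G x i) \<partial>M\<bar> \<le> vLnorm n M p F * vLnorm n M q G"
proof -
  have [measurable]: "(\<lambda>x. \<Sum>i<n. F x i * G x i) \<in> borel_measurable M"
    using F G by (intro borel_measurable_sum borel_measurable_times) (auto simp: vLp_def)
  have CS: "\<bar>\<Sum>i<n. F x i * G x i\<bar> \<le> vnorm n (F x) * vnorm n (G x)" for x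
  proof -
    have "\<bar>\<Sum>i<n. F x i * G x i\<bar> \<le> (\<Sum>i<n. \<bar>F x i\<bar> * \<bar>G x i\<bar>)"
      using sum_abs[of "\<lambda>i. F x i * G x i" "{..<n}"] by (simp add: abs_mult)
    then show ?thesis
      unfolding vnorm_def using L2_set_mult_ineq order_trans by blast
  qed
  note H = Hoelder_inequality[OF pq vLp_vnorm_measurable[OF F] vLp_vnorm_measurable[OF G]
      vnorm_nonneg vnorm_nonneg vLp_integrable[OF F] vLp_integrable[OF G]]
  show i: "integrable M (\<lambda>x. \<Sum>i<n. F x i * G x i)"
    by (rule Bochner_Integration.integrable_bound[OF H(1)]) (use CS in auto)
  have "\<bar>\<integral>x. (\<Sum>i<n. F x i * G x i) \<partial>M\<bar> \<le> (\<integral>x. \<bar>\<Sum>i<n. F x i * G x i\<bar> \<partial>M)"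
    using integral_norm_bound[of M "\<lambda>x. \<Sum>i<n. F x i * G x i"] by simp
  also have "\<dots> \<le> (\<integral>x. vnorm n (F x) * vnorm n (G x) \<partial>M)"
    using i H(1) CS by (intro integral_mono) auto
  also have "\<dots> \<le> vLnorm n M p F * vLnorm n M q G"
    using H(2) by (simp add: vLnorm_eq)
  finally show "\<bar>\<integral>x. (\<Sum>i<n. F x i * G x i) \<partial>M\<bar> \<le> vLnorm n M p F * vLnorm n M q G" .
qed


subsection \<open>The p-Laplacian\<close>

lemma A_grad_eq: "A_grad n p D w = (\<lambda>x. pow_map n (p - 2) (weak_grad n D w x))"
  by (simp add: A_grad_def A_map_def pow_map_def fun_eq_iff)

lemma V_grad_eq: "V_grad n p D w = (\<lambda>x. pow_map n ((p - 2) / 2) (weak_grad n D w x))"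
  by (simp add: V_grad_def V_map_def pow_map_def fun_eq_iff)

lemma plap_diff_le:
  assumes pq: "1 < q" "1 < p" "1 / q + 1 / p = 1"
    and w: "A_grad n p D w \<in> vLp n (leb_on n D) q" and u: "A_grad n p D u \<in> vLp n (leb_on n D) q"
    and \<phi>: "weak_grad n D \<phi> \<in> vLp n (leb_on n D) p"
  shows "\<bar>plap n p D w \<phi> - plap n p D u \<phi>\<bar>
    \<le> vLnorm n (leb_on n D) q (vdiff (A_grad n p D w) (A_grad n p D u))
       * vLnorm n (leb_on n D) p (weak_grad n D \<phi>)"
proof -
  let ?F = "vdiff (A_grad n p D w) (A_grad n p D u)"
  have "plap n p D w \<phi> - plap n p D u \<phi>
      = - (\<integral>x. (\<Sum>i<n. A_grad n p D w x i * weak_grad n D \<phi> x i)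
           - (\<Sum>i<n. A_grad n p D u x i * weak_grad n D \<phi> x i) \<partial>leb_on n D)"
    using vLp_pairing(1)[OF pq w \<phi>] vLp_pairing(1)[OF pq u \<phi>] by (simp add: plap_def)
  also have "\<dots> = - (\<integral>x. (\<Sum>i<n. ?F x i * weak_grad n D \<phi> x i) \<partial>leb_on n D)"
    by (simp add: vdiff_def left_diff_distrib sum_subtractf)
  finally show ?thesis
    using vLp_pairing(2)[OF pq vLp_vdiff[OF w u] \<phi>] pq by simp
qed

text \<open>Continuity in the test argument, for the passage from test functions to their
  closure.\<close>

lemma plap_test_diff_le:
  assumes pq: "1 < q" "1 < p" "1 / q + 1 / p = 1"
    and u: "A_grad n p D u \<in> vLp n (leb_on n D) q"
    and \<phi>: "weak_grad n D \<phi> \<in> vLp n (leb_on n D) p" and \<psi>: "weak_grad n D \<psi> \<in> vLp n (leb_on n D) p"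
  shows "\<bar>plap n p D u \<phi> - plap n p D u \<psi>\<bar>
    \<le> vLnorm n (leb_on n D) q (A_grad n p D u)
       * vLnorm n (leb_on n D) p (vdiff (weak_grad n D \<phi>) (weak_grad n D \<psi>))"
proof -
  let ?G = "vdiff (weak_grad n D \<phi>) (weak_grad n D \<psi>)"
  have "plap n p D u \<phi> - plap n p D u \<psi>
      = - (\<integral>x. (\<Sum>i<n. A_grad n p D u x i * weak_grad n D \<phi> x i)
           - (\<Sum>i<n. A_grad n p D u x i * weak_grad n D \<psi> x i) \<partial>leb_on n D)"
    using vLp_pairing(1)[OF pq u \<phi>] vLp_pairing(1)[OF pq u \<psi>] by (simp add: plap_def)
  also have "\<dots> = - (\<integral>x. (\<Sum>i<n. A_grad n p D u x i * ?G x i) \<partial>leb_on n D)"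
    by (simp add: vdiff_def right_diff_distrib sum_subtractf)
  finally show ?thesis
    using vLp_pairing(2)[OF pq u vLp_vdiff[OF \<phi> \<psi>]] pq by simp
qed

text \<open>Harmonicity is tested on \<open>Cc_inf\<close> only, while the dual norm ranges over
  \<open>W1p_0\<close>. The bound \<open>plap_test_diff_le\<close> closes the gap, as the functional
  vanishes along the approximating sequence.\<close>

lemma p_harmonic_plap_eq_0:
  assumes pq: "1 < q" "1 < p" "1 / q + 1 / p = 1"
    and D: "openin (top_of_set (Rn n)) D"
    and u: "A_grad n p D u \<in> vLp n (leb_on n D) q" and harm: "p_harmonic n p D u"
    and \<phi>: "\<phi> \<in> W1p_0 n p D"
  shows "plap n p D u \<phi> = 0"
proof -
  obtain \<psi> where \<psi>: "\<And>k. \<psi> k \<in> Cc_inf n D" "W1p_tendsto n p D \<psi> \<phi>"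
    using \<phi> by (auto simp: W1p_0_def)
  let ?e = "\<lambda>k. vLnorm n (leb_on n D) p (vdiff (weak_grad n D (\<psi> k)) (weak_grad n D \<phi>))"
  have g: "\<And>k. weak_grad n D (\<psi> k) \<in> vLp n (leb_on n D) p" "weak_grad n D \<phi> \<in> vLp n (leb_on n D) p"
      "?e \<longlonglongrightarrow> 0"
    using W1p_tendsto_weak_grad[OF D \<psi>(2)] pq by (auto simp: vLp_tendsto_def)
  have "\<bar>plap n p D u \<phi>\<bar> \<le> vLnorm n (leb_on n D) q (A_grad n p D u) * ?e k" for k
    using plap_test_diff_le[OF pq u g(1)[of k] g(2)] harm \<psi>(1)[of k] by (simp add: p_harmonic_def)
  then have "\<bar>plap n p D u \<phi>\<bar> \<le> 0"
    by (intro LIMSEQ_le_const[OF tendsto_mult_right_zero[OF g(3)]]) blast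
  then show ?thesis by simp
qed

lemma W1p_0_weak_grad:
  assumes "openin (top_of_set (Rn n)) D" "\<phi> \<in> W1p_0 n p D"
  shows "weak_grad n D \<phi> \<in> vLp n (leb_on n D) p"
  using W1p_weak_grad(2)[OF assms(1)] assms(2) by (auto simp: W1p_0_def W1p_tendsto_def)

lemma dual_norm_le:
  assumes "\<And>\<phi>. \<phi> \<in> W1p_0 n p D \<Longrightarrow> \<bar>T \<phi>\<bar> \<le> B * vLnorm n (leb_on n D) p (weak_grad n D \<phi>)" "0 \<le> B"
  shows "dual_norm n p D T \<le> ennreal B"
  unfolding dual_norm_def
proof (intro SUP_least ennreal_leI)
  fix \<phi> assume "\<phi> \<in> {\<phi> \<in> W1p_0 n p D. vLnorm n (leb_on n D) p (weak_grad n D \<phi>) \<le> 1}"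
  then show "\<bar>T \<phi>\<bar> \<le> B"
    using order_trans[OF assms(1)[of \<phi>] mult_left_mono[of _ 1 B]] assms(2) by auto
qed

theorem proposition13p1:
  fixes p p' :: real
  assumes "1 < p" and "p' = p / (p - 1)"
  shows "\<exists>C::real. \<forall>n\<ge>1. \<forall>D. openin (top_of_set (Rn n)) D \<and> bounded_Rn n D \<longrightarrow>
    (\<forall>w \<in> W1p n p D. \<forall>u \<in> W1p n p D.
       vdiff (A_grad n p D w) (A_grad n p D u) \<in> vLp n (leb_on n D) p' \<and>
       vLnorm n (leb_on n D) p' (vdiff (A_grad n p D w) (A_grad n p D u)) \<le>
         (if 2 \<le> p then
            C * (vLnorm n (leb_on n D) p (weak_grad n D w) +
                 vLnorm n (leb_on n D) p (weak_grad n D u)) powr (p - 2) *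
              vLnorm n (leb_on n D) p (vdiff (weak_grad n D w) (weak_grad n D u))
          else
            C * vLnorm n (leb_on n D) p (vdiff (weak_grad n D w) (weak_grad n D u)) powr (p - 1))) \<and>
    (\<forall>w u. W1p_tendsto n p D w u \<longrightarrow>
       vLp_tendsto n (leb_on n D) p' (\<lambda>j. A_grad n p D (w j)) (A_grad n p D u) \<and>
       vLp_tendsto n (leb_on n D) 2 (\<lambda>j. V_grad n p D (w j)) (V_grad n p D u) \<and>
       (\<forall>j. dual_norm n p D (\<lambda>\<phi>. plap n p D (w j) \<phi> - plap n p D u \<phi>)
              \<le> ennreal (vLnorm n (leb_on n D) p' (vdiff (A_grad n p D (w j)) (A_grad n p D u)))) \<and>
       (\<lambda>j. vLnorm n (leb_on n D) p' (vdiff (A_grad n p D (w j)) (A_grad n p D u))) \<longlonglongrightarrow> 0 \<and>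
       (p_harmonic n p D u \<longrightarrow>
         (\<forall>j. dual_norm n p D (plap n p D (w j))
                \<le> ennreal (vLnorm n (leb_on n D) p' (vdiff (A_grad n p D (w j)) (A_grad n p D u)))) \<and>
         (\<lambda>j. vLnorm n (leb_on n D) p' (vdiff (A_grad n p D (w j)) (A_grad n p D u))) \<longlonglongrightarrow> 0))"
proof -
  have p: "1 \<le> p" "0 < p" "-1 < p - 2" "-1 < (p - 2) / 2"
    using assms(1) by auto
  have p': "p / (p - 2 + 1) = p'" "p / ((p - 2) / 2 + 1) = 2"
    using assms by (auto simp: field_simps)
  have pq: "1 < p'" "1 < p" "1 / p' + 1 / p = 1"
    using assms(1) unfolding assms(2) by (simp_all flip: add_divide_distrib)
  \<comment> \<open>These are the constants \<open>(1 + s) * 4 powr s\<close> and 2 of the two norm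
    estimates at \<open>s = p - 2\<close>.\<close>
  define C where "C = (if 2 \<le> p then (p - 1) * 4 powr (p - 2) else 2)"
  have A_mem: "A_grad n p D w \<in> vLp n (leb_on n D) p'"
    if "openin (top_of_set (Rn n)) D" "w \<in> W1p n p D" for n D w
    using vLp_pow_map[OF W1p_weak_grad(2)[OF that] p(3)] by (simp only: A_grad_eq p')
  have est_mem: "vdiff (A_grad n p D w) (A_grad n p D u) \<in> vLp n (leb_on n D) p'"
    if D: "openin (top_of_set (Rn n)) D" and w: "w \<in> W1p n p D" and u: "u \<in> W1p n p D" for n D w u
    using vLp_vdiff[OF A_mem[OF D w] A_mem[OF D u]] pq by simp
  have est_le: "vLnorm n (leb_on n D) p' (vdiff (A_grad n p D w) (A_grad n p D u)) \<le>
         (if 2 \<le> p then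
            C * (vLnorm n (leb_on n D) p (weak_grad n D w) +
                 vLnorm n (leb_on n D) p (weak_grad n D u)) powr (p - 2) *
              vLnorm n (leb_on n D) p (vdiff (weak_grad n D w) (weak_grad n D u))
          else
            C * vLnorm n (leb_on n D) p (vdiff (weak_grad n D w) (weak_grad n D u)) powr (p - 1))"
    if D: "openin (top_of_set (Rn n)) D" and w: "w \<in> W1p n p D" and u: "u \<in> W1p n p D" for n D w u
  proof -
    note g = W1p_weak_grad(2)[OF D w] W1p_weak_grad(2)[OF D u]
    show ?thesis
    proof (cases "2 \<le> p")
      case True
      then show ?thesis
        using vLnorm_pow_map_diff_nonneg_exponent[OF g p(1), of "p - 2"]
        unfolding p' A_grad_eq C_def by (simp add: algebra_simps)
    next
      case False
      then show ?thesis
        using vLnorm_pow_map_diff_neg_exponent[OF g p(2,3)]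
        unfolding p' A_grad_eq C_def by simp
    qed
  qed
  have conv: "vLp_tendsto n (leb_on n D) p' (\<lambda>j. A_grad n p D (w j)) (A_grad n p D u)"
      "vLp_tendsto n (leb_on n D) 2 (\<lambda>j. V_grad n p D (w j)) (V_grad n p D u)"
    if D: "openin (top_of_set (Rn n)) D" and lim: "W1p_tendsto n p D w u" for n D w u
    using vLp_tendsto_pow_map[OF W1p_tendsto_weak_grad[OF D lim p(2)] p(1) p(3)]
      vLp_tendsto_pow_map[OF W1p_tendsto_weak_grad[OF D lim p(2)] p(1) p(4)]
    unfolding p' A_grad_eq V_grad_eq by simp_all
  have dual: "dual_norm n p D (\<lambda>\<phi>. plap n p D w \<phi> - plap n p D u \<phi>)
        \<le> ennreal (vLnorm n (leb_on n D) p' (vdiff (A_grad n p D w) (A_grad n p D u)))"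
    if D: "openin (top_of_set (Rn n)) D" and w: "w \<in> W1p n p D" and u: "u \<in> W1p n p D" for n D w u
    by (intro dual_norm_le plap_diff_le[OF pq A_mem[OF D w] A_mem[OF D u]] W1p_0_weak_grad[OF D]) simp_all
  have dual_harm: "dual_norm n p D (plap n p D w)
        \<le> ennreal (vLnorm n (leb_on n D) p' (vdiff (A_grad n p D w) (A_grad n p D u)))"
    if D: "openin (top_of_set (Rn n)) D" and w: "w \<in> W1p n p D" and u: "u \<in> W1p n p D"
      and harm: "p_harmonic n p D u" for n D w u
  proof (rule dual_norm_le)
    fix \<phi> assume \<phi>: "\<phi> \<in> W1p_0 n p D"
    show "\<bar>plap n p D w \<phi>\<bar>
        \<le> vLnorm n (leb_on n D) p' (vdiff (A_grad n p D w) (A_grad n p D u))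
          * vLnorm n (leb_on n D) p (weak_grad n D \<phi>)"
      using plap_diff_le[OF pq A_mem[OF D w] A_mem[OF D u] W1p_0_weak_grad[OF D \<phi>]]
        p_harmonic_plap_eq_0[OF pq D A_mem[OF D u] harm \<phi>] by simp
  qed simp
  have mem: "\<And>j. w j \<in> W1p n p D" "u \<in> W1p n p D" if "W1p_tendsto n p D w u" for n D w u
    using that by (auto simp: W1p_tendsto_def)
  have lim: "(\<lambda>j. vLnorm n (leb_on n D) p' (vdiff (A_grad n p D (w j)) (A_grad n p D u))) \<longlonglongrightarrow> 0"
    if "openin (top_of_set (Rn n)) D" "W1p_tendsto n p D w u" for n D w u
    using conv(1)[OF that] by (simp add: vLp_tendsto_def)
  show ?thesis
    by (intro exI[of _ C] allI impI conjI ballI; elim conjE;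
        rule est_mem est_le conv dual dual_harm lim; (assumption | rule mem)+)
qed

end
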